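(* Let $E$ be a complex Banach space and consider the following assertions: (a) $E$ does not contain a copy of $\mathrm{c}_0$. (b) For every power-bounded operator $T\in\mathscr{L}(E)$ which is power-bounded below, the following two assertions are equivalent: (1) $T$ has relatively compact orbits on $\mathrm{rg}(I-T^m)$ for some $m\in\mathbb{N}$; (2) $T$ has relatively compact orbits on $\mathrm{rg}(I-T^m)$ for each $m\in\mathbb{N}$. (c) For every doubly power-bounded operator $T\in\mathscr{L}(E)$, the following two assertions are equivalent: (1) $T$ has relatively compact orbits on $\mathrm{rg}(I-T^m)$ for some $m\in\mathbb{N}$; (2) $T$ has relatively compact orbits on $\mathrm{rg}(I-T^m)$ for each $m\in\mathbb{N}$. Then (a) $\Rightarrow$ (b) $\Rightarrow$ (c). If $E$ is separable, then all three statements (a), (b), (c) are equivalent.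
   Context: $\mathbb{N}=\{1,2,3,\dots\}$. $\mathscr{L}(E)$ denotes the bounded linear operators on $E$, $I$ the identity operator, and $\mathrm{rg}$ the range. $T\in\mathscr{L}(E)$ is power-bounded if $\sup_{n\in\mathbb{N}}\|T^n\|<\infty$; it is power-bounded below if $\inf_{n\in\mathbb{N}}\|T^nx\|>0$ for every $x\in E\setminus\{0\}$; it is doubly power-bounded if it is invertible and both $T$ and $T^{-1}$ are power-bounded. For a linear subspace $F\subseteq E$, $T$ has relatively compact orbits on $F$ if $\{T^ny\mid n\in\mathbb{N}\}$ is relatively compact in norm for every $y\in F$. $\mathrm{c}_0$ is the Banach space of complex null sequences with the supremum norm; "$E$ contains a copy of $\mathrm{c}_0$" means that some closed subspace of $E$ is linearly homeomorphic to $\mathrm{c}_0$. *)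

theory Defs
  imports "HOL-Analysis.Analysis"
begin

section \<open>Complex Banach spaces\<close>

text \<open>HOL-Analysis provides only real normed spaces as type classes. A complex normed space is a
  real one whose scalar multiplication extends to the complex numbers, homogeneously for the norm.\<close>

class complex_normed_vector = real_normed_vector +
  fixes scaleC :: "complex \<Rightarrow> 'a \<Rightarrow> 'a"  (infixr "*\<^sub>C" 75)
  assumes scaleC_add_right: "c *\<^sub>C (x + y) = c *\<^sub>C x + c *\<^sub>C y"
    and scaleC_add_left: "(c + d) *\<^sub>C x = c *\<^sub>C x + d *\<^sub>C x"
    and scaleC_scaleC: "c *\<^sub>C d *\<^sub>C x = (c * d) *\<^sub>C x"
    and scaleC_one: "1 *\<^sub>C x = x"
    and scaleC_of_real: "complex_of_real r *\<^sub>C x = r *\<^sub>R x"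
    and norm_scaleC: "norm (c *\<^sub>C x) = cmod c * norm x"

class complex_banach = complex_normed_vector + complete_space

lemma vector_space_scaleC:
  "vector_space (scaleC :: complex \<Rightarrow> 'a \<Rightarrow> 'a::complex_normed_vector)"
  by unfold_locales
    (simp_all add: scaleC_add_right scaleC_add_left scaleC_scaleC scaleC_one)

instantiation complex :: complex_banach
begin

definition scaleC_complex :: "complex \<Rightarrow> complex \<Rightarrow> complex"
  where "scaleC_complex c z = c * z"

instance
  by standard (simp_all add: scaleC_complex_def algebra_simps norm_mult scaleR_conv_of_real)

end

lemma bounded_scaleC_comp:
  fixes f :: "'a \<Rightarrow> 'b::complex_normed_vector"
  assumes "bounded (f ` S)"
  shows "bounded ((\<lambda>x. c *\<^sub>C f x) ` S)"
proof -
  obtain B where "\<And>x. x \<in> S \<Longrightarrow> norm (f x) \<le> B"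
    using assms by (auto simp: bounded_iff)
  then show ?thesis
    by (intro boundedI[where B = "cmod c * B"]) (auto simp: norm_scaleC intro!: mult_left_mono)
qed

lemma bounded_linear_scaleC_right:
  "bounded_linear (\<lambda>x::'a::complex_normed_vector. c *\<^sub>C x)"
proof (rule bounded_linear_intro[where K = "cmod c"])
  fix r :: real and x :: 'a
  show "c *\<^sub>C r *\<^sub>R x = r *\<^sub>R c *\<^sub>C x"
    by (simp add: scaleC_of_real[symmetric] scaleC_scaleC mult.commute)
qed (simp_all add: scaleC_add_right norm_scaleC mult.commute)

lemma scaleC_cont: "f \<in> bcontfun \<Longrightarrow> (\<lambda>x. c *\<^sub>C f x) \<in> bcontfun"
  for f :: "'a::topological_space \<Rightarrow> 'b::complex_normed_vector"
  by (auto simp: bcontfun_def intro: bounded_scaleC_comp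
      bounded_linear.continuous_on[OF bounded_linear_scaleC_right])

unbundle bcontfun.lifting

instantiation bcontfun :: (topological_space, complex_normed_vector) complex_normed_vector
begin

lift_definition scaleC_bcontfun :: "complex \<Rightarrow> ('a \<Rightarrow>\<^sub>C 'b) \<Rightarrow> 'a \<Rightarrow>\<^sub>C 'b"
  is "\<lambda>c f x. c *\<^sub>C f x"
  by (rule scaleC_cont)

instance
proof
  fix c d :: complex and r :: real and f g :: "'a \<Rightarrow>\<^sub>C 'b"
  show "c *\<^sub>C (f + g) = c *\<^sub>C f + c *\<^sub>C g"
    by transfer (simp add: scaleC_add_right)
  show "(c + d) *\<^sub>C f = c *\<^sub>C f + d *\<^sub>C f"
    by transfer (simp add: scaleC_add_left)
  show assoc: "c *\<^sub>C d *\<^sub>C f = (c * d) *\<^sub>C f" for c d and f :: "'a \<Rightarrow>\<^sub>C 'b"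
    by transfer (simp add: scaleC_scaleC)
  show one: "1 *\<^sub>C f = f" for f :: "'a \<Rightarrow>\<^sub>C 'b"
    by transfer (simp add: scaleC_one)
  show "complex_of_real r *\<^sub>C f = r *\<^sub>R f"
    by transfer (simp add: scaleC_of_real)
  have le: "norm (c *\<^sub>C f) \<le> cmod c * norm f" for c and f :: "'a \<Rightarrow>\<^sub>C 'b"
    by (rule norm_bound)
      (simp add: scaleC_bcontfun.rep_eq norm_scaleC mult_left_mono norm_bounded)
  show "norm (c *\<^sub>C f) = cmod c * norm f"
  proof (cases "c = 0")
    case True
    then show ?thesis
      using le[of 0 f] by simp
  next
    case False
    have "norm f = norm (inverse c *\<^sub>C c *\<^sub>C f)"
      using False by (simp add: assoc one)
    also have "\<dots> \<le> cmod (inverse c) * norm (c *\<^sub>C f)"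
      by (rule le)
    finally have "cmod c * norm f \<le> norm (c *\<^sub>C f)"
      using False by (simp add: norm_divide field_simps)
    with le[of c f] show ?thesis
      by simp
  qed
qed

end

instance bcontfun :: (metric_space, complex_banach) complex_banach ..


section \<open>Copies of \<open>c\<^sub>0\<close>\<close>

text \<open>Every function on the discrete space \<^typ>\<open>nat\<close> is continuous, so
  \<^typ>\<open>(nat, complex) bcontfun\<close> is the space of bounded complex sequences with the supremum norm.\<close>

definition c0 :: "(nat, complex) bcontfun set"
  where "c0 = {a. apply_bcontfun a \<longlonglongrightarrow> 0}"

lemma apply_bcontfun_image_c0: "apply_bcontfun ` c0 = {a. a \<longlonglongrightarrow> 0}"
proof safe
  fix a :: "nat \<Rightarrow> complex"
  assume a: "a \<longlonglongrightarrow> 0"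
  then have "a \<in> bcontfun"
    by (auto simp: bcontfun_def intro: convergent_imp_bounded)
  then obtain f where "a = apply_bcontfun f"
    by (rule bcontfunE)
  with a show "a \<in> apply_bcontfun ` c0"
    by (auto simp: c0_def)
qed (simp add: c0_def)

lemma norm_eq_SUP_cmod: "norm a = (SUP n. cmod (apply_bcontfun a n))"
  for a :: "(nat, complex) bcontfun"
  by (simp add: norm_bcontfun_def dist_bcontfun.rep_eq)

definition contains_copy_of_c0 :: "'a::complex_banach itself \<Rightarrow> bool"
  where "contains_copy_of_c0 _ \<longleftrightarrow>
    (\<exists>(F :: 'a set) h g.
      closed F \<and> module.subspace scaleC F \<and>
      (\<forall>a\<in>c0. \<forall>b\<in>c0. h (a + b) = h a + h b) \<and>
      (\<forall>c. \<forall>a\<in>c0. h (c *\<^sub>C a) = c *\<^sub>C h a) \<and>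
      homeomorphism c0 F h g)"


section \<open>Power-bounded operators\<close>

text \<open>Throughout, \<open>n\<close> ranges over the positive integers.\<close>

definition bounded_clinear :: "('a::complex_normed_vector \<Rightarrow> 'b::complex_normed_vector) \<Rightarrow> bool"
  where "bounded_clinear T \<longleftrightarrow>
    Vector_Spaces.linear scaleC scaleC T \<and> (\<exists>K. \<forall>x. norm (T x) \<le> norm x * K)"

definition power_bounded :: "('a::complex_normed_vector \<Rightarrow> 'a) \<Rightarrow> bool"
  where "power_bounded T \<longleftrightarrow> bdd_above {onorm (T ^^ n) | n. n \<ge> 1}"

definition power_bounded_below :: "('a::complex_normed_vector \<Rightarrow> 'a) \<Rightarrow> bool"
  where "power_bounded_below T \<longleftrightarrow> (\<forall>x. x \<noteq> 0 \<longrightarrow> (INF n\<in>{1..}. norm ((T ^^ n) x)) > 0)"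

definition doubly_power_bounded :: "('a::complex_normed_vector \<Rightarrow> 'a) \<Rightarrow> bool"
  where "doubly_power_bounded T \<longleftrightarrow>
    (\<exists>S. bounded_clinear S \<and> S \<circ> T = id \<and> T \<circ> S = id \<and> power_bounded T \<and> power_bounded S)"

definition relatively_compact_orbits_on ::
    "('a::complex_normed_vector \<Rightarrow> 'a) \<Rightarrow> 'a set \<Rightarrow> bool"
  where "relatively_compact_orbits_on T F \<longleftrightarrow>
    (\<forall>y\<in>F. compact (closure {(T ^^ n) y | n. n \<ge> 1}))"

end

theory Submission
  imports Defs "HOL-Complex_Analysis.Great_Picard"
begin

text \<open>The implication from (a) to (b) rests on a theorem of Kadets about indefinite sums. Let \<open>T\<close>
be power-bounded and power-bounded below, and let the orbit of \<open>y = T x - x\<close> be relatively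
compact. Boundedness below makes this orbit almost periodic: \<open>T\<^sup>s y\<close> is close to \<open>y\<close> for times \<open>s\<close>
with bounded gaps (\<open>return_times_syndetic\<close>). If the orbit of \<open>x\<close> were not relatively compact, \<open>x\<close>
would be moved by a fixed amount at arbitrarily good return times of \<open>y\<close>
(\<open>noncompact_orbit_escapes\<close>). Choosing such times \<open>s k\<close> recursively, the vectors \<open>T\<^sup>s\<^sup>k x - x\<close> are
bounded away from \<open>0\<close>, while any finite sum of them almost telescopes to a difference of orbit
points and is therefore bounded (\<open>escaping_vectors_bounded_sums\<close>). By Bessaga and Pelczynski such
vectors generate a copy of \<open>c\<^sub>0\<close> (\<open>copy_of_c0_if_bounded_subset_sums\<close>), which follows from a
blocking argument of James. Applied to \<open>T\<^sup>m\<close>, this shows that in a space without a copy of \<open>c\<^sub>0\<close>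
relatively compact orbits on \<open>rg (I - T\<^sup>m)\<close> for one \<open>m\<close> entail that all orbits are relatively
compact, so (1) implies (2).

The implication from (b) to (c) holds because a doubly power-bounded operator is power-bounded
below.

For the implication from (c) to (a) in a separable space, a copy of \<open>c\<^sub>0\<close> is complemented by
Sobczyk's theorem (\<open>sobczyk\<close>), whose proof needs the Hahn--Banach theorem and pointwise
compactness of bounded sets of functionals. Hence it is enough to find a counterexample on \<open>c\<^sub>0\<close>,
or on the isomorphic space \<open>c\<close> of convergent sequences, and to extend it by the identity. There,
multiplication by \<open>w n = - exp (\<i> pi / n)\<close> serves: as \<open>w n\<^sup>2\<close> tends to \<open>1\<close>, the range of \<open>I - T\<^sup>2\<close>
consists of null sequences, on which a diagonal unimodular operator has relatively compact orbits;
but \<open>I - T\<close> maps the constant sequence \<open>1\<close> to a sequence with limit \<open>2\<close>, whose orbit is not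
relatively compact because its \<open>n\<close>-th entry is opposite to the limit after \<open>n\<close> steps
(\<open>counterexample_if_copy_of_c0\<close>).\<close>

section \<open>Return times of compact orbits\<close>

lemma compact_closure_if_finite_nets:
  fixes S :: "'a::complete_space set"
  assumes nets: "\<And>e. e > 0 \<Longrightarrow> \<exists>k. finite k \<and> S \<subseteq> (\<Union>x\<in>k. ball x e)"
  shows "compact (closure S)"
  unfolding compact_eq_totally_bounded
proof (intro conjI allI impI)
  show "complete (closure S)"
    by (simp add: complete_eq_closed)
next
  fix e :: real assume "e > 0"
  then obtain k where k: "finite k" "S \<subseteq> (\<Union>x\<in>k. ball x (e/2))"
    using nets[of "e/2"] by auto
  have "closure S \<subseteq> (\<Union>x\<in>k. cball x (e/2))"
  proof (rule closure_minimal)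
    show "S \<subseteq> (\<Union>x\<in>k. cball x (e/2))"
      using k(2) by (rule order_trans) (intro UN_mono order_refl ball_subset_cball)
    show "closed (\<Union>x\<in>k. cball x (e/2))"
      using k(1) by (intro closed_UN) auto
  qed
  also have "\<dots> \<subseteq> (\<Union>x\<in>k. ball x e)"
    using \<open>e > 0\<close> by auto
  finally show "\<exists>k. finite k \<and> closure S \<subseteq> (\<Union>x\<in>k. ball x e)"
    using k(1) by blast
qed

lemma compact_closure_subset:
  fixes S K :: "'a::metric_space set"
  assumes "compact K" "S \<subseteq> K"
  shows "compact (closure S)"
proof -
  have "closure S \<subseteq> K"
    using assms by (intro closure_minimal compact_imp_closed)
  then show ?thesis
    using compact_Int_closed[OF assms(1) closed_closure[of S]] by (simp add: Int_absorb1)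
qed

lemma linear_funpow:
  fixes T :: "'a::real_vector \<Rightarrow> 'a"
  assumes "linear T"
  shows "linear (T ^^ n)"
  by (induction n) (use linear_compose[OF _ assms] in \<open>auto simp: linear_id[unfolded id_def] o_def id_def\<close>)

locale bounded_powers =
  fixes T :: "'a::real_normed_vector \<Rightarrow> 'a" and M :: real
  assumes linear: "linear T"
    and norm_funpow_le: "norm ((T ^^ n) x) \<le> M * norm x"
    and M_ge_1: "M \<ge> 1"
begin

lemma funpow_diff: "(T ^^ n) (x - y) = (T ^^ n) x - (T ^^ n) y"
  by (rule linear_diff[OF linear_funpow[OF linear]])

lemma M_pos: "M > 0"
  using M_ge_1 by linarith

text \<open>If \<open>T\<close> were an isometry, two orbit points \<open>T\<^sup>i y\<close> and \<open>T\<^sup>i\<^sup>+\<^sup>s y\<close> would be exactly as far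
apart as \<open>y\<close> and \<open>T\<^sup>s y\<close>. On a relatively compact orbit, pointwise boundedness below replaces the
isometry: a limit \<open>z\<close> of points \<open>T\<^sup>s y\<close> that stay away from \<open>y\<close>, although the powers \<open>T\<^sup>i\<close> almost
identify them with \<open>y\<close>, would give a nonzero vector \<open>z - y\<close> whose orbit comes arbitrarily close to
\<open>0\<close>.\<close>

lemma close_orbit_points_imp_return:
  assumes below: "\<And>z. z \<noteq> 0 \<Longrightarrow> \<exists>c>0. \<forall>n. c \<le> norm ((T ^^ n) z)"
    and cpt: "compact (closure (range (\<lambda>n. (T ^^ n) y)))" and "e > 0"
  shows "\<exists>\<eta>>0. \<forall>i s. norm ((T ^^ (i + s)) y - (T ^^ i) y) < \<eta> \<longrightarrow> norm ((T ^^ s) y - y) < e"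
proof (rule ccontr)
  assume "\<not> ?thesis"
  then have "\<forall>k. \<exists>i s. norm ((T ^^ (i + s)) y - (T ^^ i) y) < 1 / real (Suc k)
      \<and> norm ((T ^^ s) y - y) \<ge> e"
    by (metis not_le of_nat_0_less_iff zero_less_Suc zero_less_divide_1_iff)
  then obtain i s where
    "is": "\<And>k. norm ((T ^^ (i k + s k)) y - (T ^^ i k) y) < 1 / real (Suc k)"
      "\<And>k. norm ((T ^^ s k) y - y) \<ge> e"
    by metis
  have "\<forall>k. (T ^^ s k) y \<in> closure (range (\<lambda>n. (T ^^ n) y))"
    using closure_subset by fast
  then obtain z r where zr: "strict_mono (r :: nat \<Rightarrow> nat)" "(\<lambda>k. (T ^^ s (r k)) y) \<longlonglongrightarrow> z"
    using cpt unfolding compact_def o_def by meson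
  have "e \<le> norm (z - y)"
    using "is"(2) by (intro tendsto_lowerbound[OF tendsto_norm[OF tendsto_diff[OF zr(2) tendsto_const]]]) auto
  then have "z - y \<noteq> 0"
    using \<open>e > 0\<close> by auto
  then obtain c where c: "c > 0" "\<And>n. c \<le> norm ((T ^^ n) (z - y))"
    using below by metis
  have "c \<le> M * norm (z - (T ^^ s (r k)) y) + 1 / real (Suc (r k))" for k
  proof -
    have "(T ^^ i (r k)) (z - y) = (T ^^ i (r k)) (z - (T ^^ s (r k)) y)
        + ((T ^^ (i (r k) + s (r k))) y - (T ^^ i (r k)) y)"
      by (simp add: funpow_diff funpow_add)
    then have "norm ((T ^^ i (r k)) (z - y)) \<le> norm ((T ^^ i (r k)) (z - (T ^^ s (r k)) y))
        + norm ((T ^^ (i (r k) + s (r k))) y - (T ^^ i (r k)) y)"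
      by (metis norm_triangle_ineq)
    with c(2)[of "i (r k)"] norm_funpow_le[of "i (r k)" "z - (T ^^ s (r k)) y"] "is"(1)[of "r k"]
    show ?thesis by linarith
  qed
  moreover have "(\<lambda>k. M * norm (z - (T ^^ s (r k)) y) + 1 / real (Suc (r k))) \<longlonglongrightarrow> M * norm (z - z) + 0"
    using LIMSEQ_subseq_LIMSEQ[OF LIMSEQ_Suc[OF lim_1_over_n] zr(1)]
    by (intro tendsto_intros zr(2)) (simp_all add: o_def)
  ultimately have "c \<le> M * norm (z - z) + 0"
    by (intro tendsto_lowerbound) auto
  with c(1) show False by simp
qed

text \<open>Total boundedness of the orbit assigns to every \<open>n\<close> an earlier time \<open>m \<le> N\<close> whose orbit
point is close to \<open>T\<^sup>n y\<close>; then \<open>n - m\<close> is a return time of \<open>y\<close>. Thus return times occur with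
bounded gaps.\<close>

lemma return_times_syndetic:
  assumes below: "\<And>z. z \<noteq> 0 \<Longrightarrow> \<exists>c>0. \<forall>n. c \<le> norm ((T ^^ n) z)"
    and cpt: "compact (closure (range (\<lambda>n. (T ^^ n) y)))" and "e > 0"
  shows "\<exists>N. \<forall>n. \<exists>m\<le>n. m \<le> N \<and> norm ((T ^^ (n - m)) y - y) < e"
proof -
  obtain \<eta> where \<eta>: "\<eta> > 0"
    "\<And>i s. norm ((T ^^ (i + s)) y - (T ^^ i) y) < \<eta> \<Longrightarrow> norm ((T ^^ s) y - y) < e"
    using close_orbit_points_imp_return[OF assms] by metis
  have "closure (range (\<lambda>n. (T ^^ n) y)) \<subseteq> (\<Union>m\<in>UNIV. ball ((T ^^ m) y) \<eta>)"
    using \<eta>(1) by (auto simp: closure_approachable)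
  then obtain D where D: "finite D" "closure (range (\<lambda>n. (T ^^ n) y)) \<subseteq> (\<Union>m\<in>D. ball ((T ^^ m) y) \<eta>)"
    using compactE_image[OF cpt, of UNIV "\<lambda>m. ball ((T ^^ m) y) \<eta>"] by (metis open_ball)
  obtain N where N: "\<And>m. m \<in> D \<Longrightarrow> m \<le> N"
    using D(1) finite_nat_set_iff_bounded_le by auto
  show ?thesis
  proof (rule exI[of _ N], rule allI)
    fix n
    show "\<exists>m\<le>n. m \<le> N \<and> norm ((T ^^ (n - m)) y - y) < e"
    proof (cases "n \<le> N")
      case True
      then show ?thesis using \<open>e > 0\<close> by (intro exI[of _ n]) auto
    next
      case False
      have "(T ^^ n) y \<in> closure (range (\<lambda>n. (T ^^ n) y))"
        using closure_subset by fast
      then obtain m where m: "m \<in> D" "dist ((T ^^ m) y) ((T ^^ n) y) < \<eta>"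
        using D(2) by (auto simp: subset_iff)
      with N[OF m(1)] False have "m \<le> n" "m \<le> N" by auto
      with \<eta>(2)[of m "n - m"] m(2) show ?thesis
        by (intro exI[of _ m]) (auto simp: dist_norm norm_minus_commute)
    qed
  qed
qed

lemma funpow_minus_self_eq_sum:
  "(T ^^ n) x - x = (\<Sum>i<n. (T ^^ i) (T x - x))"
proof (induction n)
  case (Suc n)
  have "(T ^^ Suc n) x - x = ((T ^^ n) x - x) + (T ^^ n) (T x - x)"
    by (simp add: funpow_diff funpow_swap1)
  with Suc show ?case by simp
qed simp

lemma funpow_commute: "(T ^^ m) ((T ^^ n) z) = (T ^^ n) ((T ^^ m) z)"
  by (metis add.commute comp_apply funpow_add)

text \<open>The vector \<open>T\<^sup>n x - x\<close> is the sum of the first \<open>n\<close> orbit points of \<open>T x - x\<close>. Hence one good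
return time of the single vector \<open>T x - x\<close> is also a good return time of \<open>T\<^sup>n x - x\<close> for all
bounded \<open>n\<close>.\<close>

lemma norm_coboundary_le:
  "norm ((T ^^ s) ((T ^^ n) x - x) - ((T ^^ n) x - x))
    \<le> real n * (M * norm ((T ^^ s) (T x - x) - (T x - x)))"
proof -
  have "(T ^^ s) (\<Sum>i<n. (T ^^ i) (T x - x)) - (\<Sum>i<n. (T ^^ i) (T x - x))
      = (\<Sum>i<n. (T ^^ i) ((T ^^ s) (T x - x) - (T x - x)))"
    unfolding linear_sum[OF linear_funpow[OF linear]]
    by (simp only: funpow_diff funpow_commute[of s] sum_subtractf)
  also have "norm \<dots> \<le> (\<Sum>i<n. M * norm ((T ^^ s) (T x - x) - (T x - x)))"
    by (intro sum_norm_le norm_funpow_le)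
  finally show ?thesis unfolding funpow_minus_self_eq_sum[of n x] by simp
qed

text \<open>The core of the argument of Kadets. The vectors are \<open>v k = T\<^sup>s\<^sup>k x - x\<close>, where the time
\<open>s k\<close> moves \<open>x\<close> by at least \<open>\<delta>\<close> but hardly moves any \<open>T\<^sup>\<sigma> x - x\<close> with \<open>\<sigma>\<close> a sum of earlier times.
Therefore \<open>v k + (T\<^sup>\<sigma> x - x)\<close> is close to \<open>T\<^sup>s\<^sup>k\<^sup>+\<^sup>\<sigma> x - x\<close>: a sum of any selection of the \<open>v k\<close>
is, up to an error of at most \<open>2\<close>, a single difference of two orbit points, and those are
bounded.\<close>

lemma escaping_vectors_bounded_sums:
  assumes esc: "\<And>e. e > 0 \<Longrightarrow> \<exists>s. norm ((T ^^ s) (T x - x) - (T x - x)) < e \<and> norm ((T ^^ s) x - x) \<ge> \<delta>"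
  obtains v :: "nat \<Rightarrow> 'a" where "\<And>k. norm (v k) \<ge> \<delta>"
    "\<And>A. finite A \<Longrightarrow> norm (sum v A) \<le> (M + 1) * norm x + 2"
proof -
  let ?y = "T x - x"
  \<comment> \<open>The recursion builds the partial sums \<open>t k\<close> of the times, since the tolerance for the next time is
    measured by the largest sum of earlier times.\<close>
  let ?Q = "\<lambda>k t t'. t \<le> t' \<and> norm ((T ^^ (t' - t)) ?y - ?y) < (1/2) ^ k / (M * (1 + real t))
      \<and> norm ((T ^^ (t' - t)) x - x) \<ge> \<delta>"
  have "\<exists>t. \<forall>k. True \<and> ?Q k (t k) (t (Suc k))"
  proof -
    have "\<exists>t'. True \<and> ?Q k t t'" for k t
    proof -
      have "(1/2) ^ k / (M * (1 + real t)) > 0"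
        using M_pos by (intro divide_pos_pos mult_pos_pos) auto
      then obtain s where "norm ((T ^^ s) ?y - ?y) < (1/2) ^ k / (M * (1 + real t))"
        "norm ((T ^^ s) x - x) \<ge> \<delta>" using esc by metis
      then show ?thesis by (intro exI[of _ "t + s"]) auto
    qed
    then show ?thesis using dependent_nat_choice[of "\<lambda>_ _. True" ?Q] by blast
  qed
  then obtain t where t: "\<And>k. ?Q k (t k) (t (Suc k))" by blast
  define s where "s k = t (Suc k) - t k" for k
  define v where "v k = (T ^^ s k) x - x" for k
  have sum_s: "sum s A \<le> t k" if "A \<subseteq> {..<k}" for A k
  proof -
    have "sum s A \<le> sum s {..<k}" using that by (intro sum_mono2) auto
    also have "\<dots> \<le> t k"
    proof (induction k)
      case (Suc k) then show ?case using t[of k] by (simp add: s_def)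
    qed simp
    finally show ?thesis .
  qed
  have approx: "norm (sum v A - ((T ^^ sum s A) x - x)) \<le> (\<Sum>k\<in>A. (1/2) ^ k)" if "finite A" for A
    using that
  proof (induction A rule: finite_linorder_max_induct)
    case empty show ?case by simp
  next
    case (insert k A)
    let ?w = "(T ^^ sum s A) x - x"
    have k: "k \<notin> A" "A \<subseteq> {..<k}" using insert.hyps by auto
    have "norm ((T ^^ s k) ?w - ?w) \<le> real (sum s A) * (M * norm ((T ^^ s k) ?y - ?y))"
      by (rule norm_coboundary_le)
    also have "\<dots> \<le> (1 + real (t k)) * (M * ((1/2) ^ k / (M * (1 + real (t k)))))"
      using sum_s[OF k(2)] t[of k] M_pos by (intro mult_mono mult_nonneg_nonneg) (auto simp: s_def simp flip: of_nat_sum)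
    also have "\<dots> = (1/2) ^ k"
      using M_pos of_nat_0_le_iff[of "t k", where 'a = real]
      by (subst mult.assoc[symmetric], subst (2) mult.commute) auto
    finally have step: "norm ((T ^^ s k) ?w - ?w) \<le> (1/2) ^ k" .
    have "(T ^^ (s k + sum s A)) x - x = (T ^^ s k) ?w + v k"
      by (simp add: funpow_add funpow_diff v_def)
    then have "sum v (insert k A) - ((T ^^ sum s (insert k A)) x - x)
        = (sum v A - ?w) - ((T ^^ s k) ?w - ?w)"
      using k(1) insert.hyps(1) by simp
    then have "norm (sum v (insert k A) - ((T ^^ sum s (insert k A)) x - x))
        \<le> norm (sum v A - ?w) + norm ((T ^^ s k) ?w - ?w)"
      by (metis norm_triangle_ineq4)
    also have "\<dots> \<le> (\<Sum>k\<in>A. (1/2) ^ k) + (1/2) ^ k"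
      using insert.IH step by (rule add_mono)
    finally show ?case using k(1) insert.hyps(1) by (simp add: add.commute)
  qed
  show thesis
  proof
    show "norm (v k) \<ge> \<delta>" for k
      using t[of k] by (simp add: v_def s_def)
    fix A :: "nat set" assume A: "finite A"
    have "(\<Sum>k\<in>A. (1/2) ^ k) \<le> (\<Sum>k. (1/2::real) ^ k)"
      using A by (intro sum_le_suminf) auto
    then have "(\<Sum>k\<in>A. (1/2::real) ^ k) \<le> 2"
      by (simp only: suminf_geometric[of "1/2 :: real", simplified])
    moreover have "norm ((T ^^ sum s A) x - x) \<le> (M + 1) * norm x"
      using norm_funpow_le[of "sum s A" x] norm_triangle_ineq4[of "(T ^^ sum s A) x" x]
      by (simp add: algebra_simps)
    moreover have "norm (sum v A) \<le> norm (sum v A - ((T ^^ sum s A) x - x)) + norm ((T ^^ sum s A) x - x)"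
      by (metis diff_add_cancel norm_triangle_ineq)
    ultimately show "norm (sum v A) \<le> (M + 1) * norm x + 2"
      using approx[OF A] by linarith
  qed
qed

end

text \<open>Suppose that, for each \<open>\<delta>\<close>, every sufficiently good return time of \<open>y\<close> moved \<open>x\<close> by less
than \<open>\<delta>\<close>. Since the return times of \<open>y\<close> have bounded gaps, the orbit of \<open>x\<close> would then stay within
\<open>M \<delta>\<close> of finitely many of its points. So a noncompact orbit has to be moved by a fixed amount at
return times of \<open>y\<close> of arbitrary quality.\<close>

lemma noncompact_orbit_escapes:
  fixes T :: "'a::{real_normed_vector, complete_space} \<Rightarrow> 'a"
  assumes "bounded_powers T M"
    and below: "\<And>z. z \<noteq> 0 \<Longrightarrow> \<exists>c>0. \<forall>n. c \<le> norm ((T ^^ n) z)"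
    and cpt: "compact (closure (range (\<lambda>n. (T ^^ n) y)))"
    and noncpt: "\<not> compact (closure (range (\<lambda>n. (T ^^ n) x)))"
  shows "\<exists>\<delta>>0. \<forall>e>0. \<exists>s. norm ((T ^^ s) y - y) < e \<and> norm ((T ^^ s) x - x) \<ge> \<delta>"
proof (rule ccontr)
  interpret bounded_powers T M by fact
  assume neg: "\<not> ?thesis"
  have "compact (closure (range (\<lambda>n. (T ^^ n) x)))"
  proof (rule compact_closure_if_finite_nets)
    fix d :: real assume "d > 0"
    then have "d / M > 0" using M_pos by simp
    then obtain e where e: "e > 0" "\<And>s. norm ((T ^^ s) y - y) < e \<Longrightarrow> norm ((T ^^ s) x - x) < d / M"
      using neg by (meson not_le)
    obtain N where N: "\<And>n. \<exists>m\<le>n. m \<le> N \<and> norm ((T ^^ (n - m)) y - y) < e"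
      using return_times_syndetic[OF below cpt e(1)] by blast
    have "(T ^^ n) x \<in> (\<Union>z\<in>(\<lambda>m. (T ^^ m) x) ` {..N}. ball z d)" for n
    proof -
      obtain m where m: "m \<le> n" "m \<le> N" "norm ((T ^^ (n - m)) y - y) < e"
        using N by blast
      have "(T ^^ n) x - (T ^^ m) x = (T ^^ m) ((T ^^ (n - m)) x - x)"
        using m(1) funpow_add[of m "n - m" T] by (simp add: funpow_diff)
      then have "norm ((T ^^ n) x - (T ^^ m) x) \<le> M * norm ((T ^^ (n - m)) x - x)"
        using norm_funpow_le by metis
      also have "\<dots> < M * (d / M)"
        using e(2)[OF m(3)] M_pos by (intro mult_strict_left_mono)
      finally show ?thesis
        using m(2) M_pos by (auto simp: dist_norm norm_minus_commute)
    qed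
    then show "\<exists>k. finite k \<and> range (\<lambda>n. (T ^^ n) x) \<subseteq> (\<Union>x\<in>k. ball x d)"
      by (intro exI[of _ "(\<lambda>m. (T ^^ m) x) ` {..N}"]) auto
  qed
  with noncpt show False by simp
qed

section \<open>Series with bounded subset sums and copies of \<open>c\<^sub>0\<close>\<close>

instance complex_banach \<subseteq> banach ..

interpretation scaleC: vector_space "scaleC :: complex \<Rightarrow> 'a \<Rightarrow> 'a::complex_normed_vector"
  by (rule vector_space_scaleC)

text \<open>A combination with coefficients in \<open>[0, 1]\<close> is a convex combination of subset sums. The
induction replaces one coefficient at a time by \<open>0\<close> or \<open>1\<close>; the set \<open>B\<close> collects the indices of
the ones.\<close>

lemma norm_unit_interval_combination_le:
  fixes v :: "'i \<Rightarrow> 'a::real_normed_vector"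
  assumes "finite A" and bound: "\<And>A. finite A \<Longrightarrow> norm (sum v A) \<le> C"
    and "\<And>k. k \<in> A \<Longrightarrow> 0 \<le> a k \<and> a k \<le> 1"
  shows "norm (\<Sum>k\<in>A. a k *\<^sub>R v k) \<le> C"
proof -
  have "norm ((\<Sum>k\<in>A. a k *\<^sub>R v k) + sum v B) \<le> C" if "finite B" "A \<inter> B = {}" for B
    using assms(1,3) that
  proof (induction A arbitrary: B rule: finite_induct)
    case empty
    then show ?case using bound by simp
  next
    case (insert k A)
    let ?s = "(\<Sum>k\<in>A. a k *\<^sub>R v k) + sum v B"
    let ?t = "(\<Sum>k\<in>A. a k *\<^sub>R v k) + sum v (insert k B)"
    have a: "0 \<le> a k" "a k \<le> 1" using insert.prems(1) by auto
    have "norm ?s \<le> C" "norm ?t \<le> C"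
      using insert.prems insert.hyps by (intro insert.IH; auto)+
    have "(\<Sum>k\<in>insert k A. a k *\<^sub>R v k) + sum v B = (1 - a k) *\<^sub>R ?s + a k *\<^sub>R ?t"
      using insert.prems insert.hyps by (simp add: algebra_simps)
    also have "norm \<dots> \<le> (1 - a k) * norm ?s + a k * norm ?t"
      using norm_triangle_ineq[of "(1 - a k) *\<^sub>R ?s" "a k *\<^sub>R ?t"] a by simp
    also have "\<dots> \<le> (1 - a k) * C + a k * C"
      using a \<open>norm ?s \<le> C\<close> \<open>norm ?t \<le> C\<close> by (intro add_mono mult_left_mono) auto
    also have "\<dots> = C"
      by (simp add: algebra_simps)
    finally show ?case .
  qed
  from this[of "{}"] show ?thesis by simp
qed

text \<open>The factor \<open>4\<close> arises from splitting a coefficient into real and imaginary part and each of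
them into positive and negative part.\<close>

lemma norm_unit_disc_combination_le:
  fixes v :: "'i \<Rightarrow> 'a::complex_normed_vector"
  assumes "finite A" and bound: "\<And>A. finite A \<Longrightarrow> norm (sum v A) \<le> C"
    and a: "\<And>k. k \<in> A \<Longrightarrow> cmod (a k) \<le> 1"
  shows "norm (\<Sum>k\<in>A. a k *\<^sub>C v k) \<le> 4 * C"
proof -
  let ?S = "\<lambda>r. \<Sum>k\<in>A. r k *\<^sub>R v k"
  have real: "norm (?S r) \<le> 2 * C" if r: "\<And>k. k \<in> A \<Longrightarrow> \<bar>r k\<bar> \<le> 1" for r
  proof -
    have "?S r = ?S (\<lambda>k. max 0 (r k)) - ?S (\<lambda>k. max 0 (- r k))"
      by (simp add: max_def flip: sum_subtractf scaleR_left_diff_distrib)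
        (auto intro!: sum.cong)
    moreover have "norm (?S (\<lambda>k. max 0 (r k))) \<le> C" "norm (?S (\<lambda>k. max 0 (- r k))) \<le> C"
      using r by (intro norm_unit_interval_combination_le assms(1) bound; fastforce)+
    ultimately show ?thesis
      using norm_triangle_ineq4[of "?S (\<lambda>k. max 0 (r k))" "?S (\<lambda>k. max 0 (- r k))"] by simp
  qed
  have split: "c *\<^sub>C x = Re c *\<^sub>R x + \<i> *\<^sub>C (Im c *\<^sub>R x)" for c and x :: 'a
    using scaleC_add_left[of "of_real (Re c)" "\<i> * of_real (Im c)" x]
    by (simp only: complex_eq[symmetric] scaleC_scaleC[symmetric] scaleC_of_real)
  have "(\<Sum>k\<in>A. a k *\<^sub>C v k) = ?S (\<lambda>k. Re (a k)) + \<i> *\<^sub>C ?S (\<lambda>k. Im (a k))"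
    unfolding split[of "a _"] sum.distrib scaleC.scale_sum_right ..
  then have "norm (\<Sum>k\<in>A. a k *\<^sub>C v k) \<le> norm (?S (\<lambda>k. Re (a k))) + norm (?S (\<lambda>k. Im (a k)))"
    using norm_triangle_ineq[of "?S (\<lambda>k. Re (a k))" "\<i> *\<^sub>C ?S (\<lambda>k. Im (a k))"]
    by (simp add: norm_scaleC)
  also have "\<dots> \<le> 2 * C + 2 * C"
    using a by (intro add_mono real)
      (meson order_trans abs_Re_le_cmod abs_Im_le_cmod)+
  finally show ?thesis by simp
qed

definition unit_vector :: "nat \<Rightarrow> (nat, complex) bcontfun"
  where "unit_vector i = Bcontfun (\<lambda>j. if j = i then 1 else 0)"

lemma c0_tendsto: "a \<in> c0 \<Longrightarrow> apply_bcontfun a \<longlonglongrightarrow> 0"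
  by (simp add: c0_def)

lemma obtain_c0:
  assumes "f \<longlonglongrightarrow> 0"
  obtains a where "a \<in> c0" "apply_bcontfun a = f"
  using assms apply_bcontfun_image_c0 by (metis (mono_tags, lifting) imageE mem_Collect_eq)

lemma apply_Bcontfun_null_sequence:
  fixes f :: "nat \<Rightarrow> complex"
  assumes "f \<longlonglongrightarrow> 0"
  shows "apply_bcontfun (Bcontfun f) = f"
  by (metis assms obtain_c0 apply_bcontfun_inverse)

lemma Bcontfun_null_sequence_c0: "f \<longlonglongrightarrow> 0 \<Longrightarrow> Bcontfun f \<in> c0"
  by (metis apply_bcontfun_inverse obtain_c0)

lemma apply_unit_vector: "apply_bcontfun (unit_vector i) = (\<lambda>j. if j = i then 1 else 0)"
  unfolding unit_vector_def
  by (intro apply_Bcontfun_null_sequence tendsto_eventually eventually_sequentiallyI[of "Suc i"]) auto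

lemma unit_vector_c0: "unit_vector i \<in> c0"
  by (auto simp: c0_def apply_unit_vector intro!: tendsto_eventually eventually_sequentiallyI[of "Suc i"])

lemma c0_add: "a \<in> c0 \<Longrightarrow> b \<in> c0 \<Longrightarrow> a + b \<in> c0"
  unfolding c0_def using tendsto_add[of "apply_bcontfun a" 0 _ "apply_bcontfun b" 0]
  by (simp add: plus_bcontfun.rep_eq)

lemma c0_diff: "a \<in> c0 \<Longrightarrow> b \<in> c0 \<Longrightarrow> a - b \<in> c0"
  unfolding c0_def using tendsto_diff[of "apply_bcontfun a" 0 _ "apply_bcontfun b" 0]
  by (simp add: minus_bcontfun.rep_eq)

lemma c0_scaleC: "a \<in> c0 \<Longrightarrow> c *\<^sub>C a \<in> c0"
  unfolding c0_def using tendsto_mult_right_zero[of "apply_bcontfun a" _ c]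
  by (simp add: scaleC_bcontfun.rep_eq scaleC_complex_def)

lemma c0_0: "0 \<in> c0"
  by (simp add: c0_def)

text \<open>The entrywise limit is attained uniformly in the entries, by the Cauchy condition; hence it
is approximated uniformly by null sequences and is itself one.\<close>

lemma c0_complete:
  assumes a: "\<And>n. a n \<in> c0" and "Cauchy a"
  shows "\<exists>b\<in>c0. a \<longlonglongrightarrow> b"
proof -
  have entry_le: "cmod (apply_bcontfun (a m) j - apply_bcontfun (a n) j) \<le> norm (a m - a n)" for m n j
    using norm_bounded[of "a m - a n" j] by (simp add: minus_bcontfun.rep_eq)
  have "Cauchy (\<lambda>n. apply_bcontfun (a n) j)" for j
    using \<open>Cauchy a\<close> entry_le unfolding Cauchy_iff by (meson le_less_trans)
  then have "\<exists>l. (\<lambda>n. apply_bcontfun (a n) j) \<longlonglongrightarrow> l" for j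
    by (simp add: Cauchy_convergent_iff convergent_def)
  then obtain l where l: "\<And>j. (\<lambda>n. apply_bcontfun (a n) j) \<longlonglongrightarrow> l j"
    by metis
  have unif: "\<exists>N. \<forall>n\<ge>N. \<forall>j. cmod (apply_bcontfun (a n) j - l j) \<le> e" if "e > 0" for e
  proof -
    obtain N where N: "\<And>m n. m \<ge> N \<Longrightarrow> n \<ge> N \<Longrightarrow> norm (a m - a n) < e"
      using CauchyD[OF \<open>Cauchy a\<close> \<open>e > 0\<close>] by blast
    have "cmod (apply_bcontfun (a n) j - l j) \<le> e" if "n \<ge> N" for n j
    proof (rule tendsto_upperbound[OF tendsto_norm[OF tendsto_diff[OF tendsto_const l]]])
      show "\<forall>\<^sub>F i in sequentially. cmod (apply_bcontfun (a n) j - apply_bcontfun (a i) j) \<le> e"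
        using eventually_ge_at_top[of N]
        by eventually_elim (use N[OF that] entry_le in \<open>meson le_less_trans less_imp_le\<close>)
    qed simp
    then show ?thesis by blast
  qed
  have "l \<longlonglongrightarrow> 0"
  proof (rule LIMSEQ_I)
    fix e :: real assume "e > 0"
    then obtain m where m: "\<And>j. cmod (apply_bcontfun (a m) j - l j) \<le> e / 2"
      using unif[of "e / 2"] by auto
    obtain N where N: "\<And>j. j \<ge> N \<Longrightarrow> cmod (apply_bcontfun (a m) j) < e / 2"
      using LIMSEQ_D[OF c0_tendsto[OF a], of "e / 2" m] \<open>e > 0\<close> by auto
    have "cmod (l j - 0) < e" if "j \<ge> N" for j
      using norm_triangle_ineq4[of "apply_bcontfun (a m) j" "apply_bcontfun (a m) j - l j"]
        m[of j] N[OF that] by simp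
    then show "\<exists>N. \<forall>j\<ge>N. cmod (l j - 0) < e" by blast
  qed
  then obtain b where b: "b \<in> c0" "apply_bcontfun b = l"
    by (rule obtain_c0)
  have "a \<longlonglongrightarrow> b"
  proof (rule LIMSEQ_I)
    fix e :: real assume "e > 0"
    then obtain N where N: "\<And>n j. n \<ge> N \<Longrightarrow> cmod (apply_bcontfun (a n) j - l j) \<le> e / 2"
      using unif[of "e / 2"] by auto
    have "norm (a n - b) \<le> e / 2" if "n \<ge> N" for n
      using N[OF that] b(2) by (intro norm_bound) (simp add: minus_bcontfun.rep_eq)
    with \<open>e > 0\<close> show "\<exists>N. \<forall>n\<ge>N. norm (a n - b) < e"
      by (intro exI[of _ N]) force
  qed
  with b(1) show ?thesis by blast
qed

text \<open>The image is closed because a Cauchy sequence in it pulls back to a Cauchy sequence in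
\<open>c\<^sub>0\<close>, which is complete.\<close>

lemma c0_embeds_if_bounded_below:
  fixes h :: "(nat, complex) bcontfun \<Rightarrow> 'a::complex_banach"
  assumes add: "\<And>a b. a \<in> c0 \<Longrightarrow> b \<in> c0 \<Longrightarrow> h (a + b) = h a + h b"
    and scale: "\<And>c a. a \<in> c0 \<Longrightarrow> h (c *\<^sub>C a) = c *\<^sub>C h a"
    and upper: "\<And>a. a \<in> c0 \<Longrightarrow> norm (h a) \<le> R * norm a"
    and lower: "\<And>a. a \<in> c0 \<Longrightarrow> r * norm a \<le> norm (h a)" and "r > 0"
  shows "contains_copy_of_c0 TYPE('a)"
proof -
  have diff: "h (a - b) = h a - h b" if "a \<in> c0" "b \<in> c0" for a b
    using add[OF c0_diff[OF that] that(2)] by (simp add: algebra_simps)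
  have inj: "inj_on h c0"
  proof (rule inj_onI)
    fix a b assume ab: "a \<in> c0" "b \<in> c0" "h a = h b"
    then have "r * norm (a - b) \<le> 0"
      using lower[OF c0_diff[OF ab(1,2)]] by (simp add: diff)
    with \<open>r > 0\<close> show "a = b"
      by (simp add: mult_le_0_iff)
  qed
  define g where "g = the_inv_into c0 h"
  have gh: "g (h a) = a" if "a \<in> c0" for a
    unfolding g_def by (rule the_inv_into_f_f[OF inj that])
  have h_lip: "norm (h a - h b) \<le> R * norm (a - b)" if "a \<in> c0" "b \<in> c0" for a b
    using upper[OF c0_diff[OF that]] by (simp add: diff that)
  have h_low: "norm (a - b) \<le> norm (h a - h b) / r" if "a \<in> c0" "b \<in> c0" for a b
    using lower[OF c0_diff[OF that]] \<open>r > 0\<close> by (simp add: diff that field_simps)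
  have "continuous_on c0 h"
  proof (rule lipschitz_on_continuous_on)
    show "\<bar>R\<bar>-lipschitz_on c0 h"
    proof (rule lipschitz_onI)
      fix a b :: "(nat, complex) bcontfun" assume "a \<in> c0" "b \<in> c0"
      with h_lip[of a b] show "dist (h a) (h b) \<le> \<bar>R\<bar> * dist a b"
        unfolding dist_norm by (smt (verit) mult_right_mono norm_ge_zero)
    qed simp
  qed
  moreover have "continuous_on (h ` c0) g"
  proof (rule lipschitz_on_continuous_on)
    show "(1 / r)-lipschitz_on (h ` c0) g"
      by (rule lipschitz_onI) (use \<open>r > 0\<close> h_low in \<open>auto simp: gh dist_norm\<close>)
  qed
  ultimately have "homeomorphism c0 (h ` c0) h g"
    by (intro homeomorphismI) (auto simp: gh)
  moreover have "closed (h ` c0)"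
    unfolding closed_sequential_limits
  proof (intro allI impI, elim conjE)
    fix f l assume f: "\<forall>n. f n \<in> h ` c0" "f \<longlonglongrightarrow> l"
    define a where "a n = g (f n)" for n
    have a: "a n \<in> c0" "f n = h (a n)" for n
    proof -
      obtain b where "b \<in> c0" "f n = h b" using f(1) by blast
      then show "a n \<in> c0" "f n = h (a n)" by (simp_all add: a_def gh)
    qed
    have "Cauchy a"
    proof (rule CauchyI)
      fix e :: real assume "e > 0"
      then obtain N where N: "\<And>m n. m \<ge> N \<Longrightarrow> n \<ge> N \<Longrightarrow> norm (f m - f n) < e * r"
        using CauchyD[OF LIMSEQ_imp_Cauchy[OF f(2)], of "e * r"] \<open>r > 0\<close> by auto
      have "norm (a m - a n) < e" if "m \<ge> N" "n \<ge> N" for m n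
      proof -
        have "norm (a m - a n) \<le> norm (f m - f n) / r"
          using h_low[OF a(1) a(1)] by (simp add: a(2))
        also have "\<dots> < e"
          using N[OF that] \<open>r > 0\<close> by (simp add: pos_divide_less_eq)
        finally show ?thesis .
      qed
      then show "\<exists>M. \<forall>m\<ge>M. \<forall>n\<ge>M. norm (a m - a n) < e" by blast
    qed
    then obtain b where b: "a \<longlonglongrightarrow> b" "b \<in> c0"
      using c0_complete a(1) by blast
    have "(\<lambda>n. h (a n)) \<longlonglongrightarrow> h b"
      using continuous_on_tendsto_compose[OF \<open>continuous_on c0 h\<close> b] a(1) by simp
    then have "l = h b"
      using LIMSEQ_unique[OF f(2)] by (simp flip: a(2))
    with b(2) show "l \<in> h ` c0" by blast
  qed
  moreover have "module.subspace scaleC (h ` c0)"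
    unfolding scaleC.subspace_def
    using scale[OF c0_0, of 0] c0_0
    by (auto simp: image_iff) (metis add c0_add, metis scale c0_scaleC)
  ultimately show ?thesis
    unfolding contains_copy_of_c0_def using add scale by blast
qed

text \<open>The map \<open>a \<mapsto> \<Sum>j. a j u j\<close> is bounded by \<open>R\<close>. If the sign of all entries of \<open>a\<close> but the
\<open>i\<close>-th is reversed, the norm of \<open>a\<close> is unchanged, and the two images add up to \<open>2 a i u i\<close>. As
that sum has norm at least \<open>2 r\<close> when \<open>a i\<close> is a normalised largest entry, while one summand
contributes at most \<open>R < 2 r\<close>, the other summand cannot be small. This sign change is due to
James.\<close>

lemma copy_of_c0_if_bounded_combinations:
  fixes u :: "nat \<Rightarrow> 'a::complex_banach"
  assumes u: "\<And>j. norm (u j) \<ge> r"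
    and R: "\<And>b L. (\<And>j. cmod (b j) \<le> 1) \<Longrightarrow> norm (\<Sum>j<L. b j *\<^sub>C u j) \<le> R"
    and "R < 2 * r"
  shows "contains_copy_of_c0 TYPE('a)"
proof -
  have "R \<ge> 0" using R[of "\<lambda>_. 0" 0] by simp
  have scaled: "norm (\<Sum>j\<in>{m..<n}. b j *\<^sub>C u j) \<le> R * \<beta>"
    if b: "\<And>j. j \<ge> m \<Longrightarrow> cmod (b j) \<le> \<beta>" and "\<beta> > 0" for b \<beta> m n
  proof -
    let ?d = "\<lambda>j. if j < m then 0 else b j / of_real \<beta>"
    have "(\<Sum>j\<in>{m..<n}. b j *\<^sub>C u j) = (\<Sum>j\<in>{m..<n}. of_real \<beta> *\<^sub>C ?d j *\<^sub>C u j)"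
      using \<open>\<beta> > 0\<close> by (intro sum.cong) (auto simp: scaleC_scaleC)
    also have "\<dots> = of_real \<beta> *\<^sub>C (\<Sum>j\<in>{m..<n}. ?d j *\<^sub>C u j)"
      by (simp add: scaleC.scale_sum_right)
    also have "(\<Sum>j\<in>{m..<n}. ?d j *\<^sub>C u j) = (\<Sum>j<n. ?d j *\<^sub>C u j)"
      by (intro sum.mono_neutral_left) auto
    also have "norm (of_real \<beta> *\<^sub>C \<dots>) = \<beta> * norm (\<Sum>j<n. ?d j *\<^sub>C u j)"
      using \<open>\<beta> > 0\<close> by (simp add: norm_scaleC)
    also have "\<dots> \<le> \<beta> * R"
      using \<open>\<beta> > 0\<close> b by (intro mult_left_mono R) (auto simp: norm_divide)
    finally show ?thesis by (simp add: mult.commute)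
  qed
  have summable: "summable (\<lambda>j. apply_bcontfun a j *\<^sub>C u j)" if "a \<in> c0" for a
    unfolding summable_Cauchy
  proof (intro allI impI)
    fix e :: real assume "e > 0"
    define \<beta> where "\<beta> = e / (R + 1)"
    have \<beta>: "\<beta> > 0" "R * \<beta> < e"
      using \<open>e > 0\<close> \<open>R \<ge> 0\<close> by (auto simp: \<beta>_def field_simps)
    obtain N where N: "\<And>n. n \<ge> N \<Longrightarrow> cmod (apply_bcontfun a n) < \<beta>"
      using LIMSEQ_D[OF c0_tendsto[OF \<open>a \<in> c0\<close>] \<beta>(1)] by auto
    have "norm (\<Sum>j\<in>{m..<n}. apply_bcontfun a j *\<^sub>C u j) < e" if "m \<ge> N" for m n
    proof (rule le_less_trans[OF scaled[OF _ \<beta>(1)] \<beta>(2)])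
      show "cmod (apply_bcontfun a j) \<le> \<beta>" if "j \<ge> m" for j
        using N[of j] that \<open>m \<ge> N\<close> by simp
    qed
    then show "\<exists>N. \<forall>m\<ge>N. \<forall>n. norm (\<Sum>j\<in>{m..<n}. apply_bcontfun a j *\<^sub>C u j) < e" by blast
  qed
  define h where "h a = (\<Sum>j. apply_bcontfun a j *\<^sub>C u j)" for a
  have add: "h (a + b) = h a + h b" if "a \<in> c0" "b \<in> c0" for a b
    unfolding h_def using suminf_add[OF summable[OF that(1)] summable[OF that(2)]]
    by (simp add: plus_bcontfun.rep_eq scaleC_add_left)
  have scale: "h (c *\<^sub>C a) = c *\<^sub>C h a" if "a \<in> c0" for a c
    unfolding h_def using bounded_linear.suminf[OF bounded_linear_scaleC_right summable[OF that], of c]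
    by (simp add: scaleC_bcontfun.rep_eq scaleC_complex_def scaleC_scaleC)
  have h_unit: "h (unit_vector i) = u i" for i
  proof -
    have "h (unit_vector i) = (\<Sum>j\<in>{i}. apply_bcontfun (unit_vector i) j *\<^sub>C u j)"
      unfolding h_def by (intro suminf_finite) (auto simp: apply_unit_vector)
    then show ?thesis by (simp add: apply_unit_vector scaleC_one)
  qed
  have upper: "norm (h a) \<le> R * norm a" if "a \<in> c0" for a
  proof (cases "a = 0")
    case True
    then show ?thesis using scale[OF that, of 0] by simp
  next
    case False
    have "(\<lambda>n. norm (\<Sum>j<n. apply_bcontfun a j *\<^sub>C u j)) \<longlonglongrightarrow> norm (h a)"
      unfolding h_def by (intro tendsto_norm summable_LIMSEQ summable that)
    then show ?thesis
      using False scaled[of 0 "apply_bcontfun a" "norm a"] norm_bounded[of a]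
      by (intro tendsto_upperbound[of _ "norm (h a)"]) (auto simp: atLeast0LessThan)
  qed
  have lower: "(2 * r - R) * norm a \<le> norm (h a)" if "a \<in> c0" for a
  proof -
    have "2 * r * cmod (apply_bcontfun a i) \<le> norm (h a) + R * norm a" for i
    proof -
      define z where "z = apply_bcontfun a i"
      define a' where "a' = (2 * z) *\<^sub>C unit_vector i - a"
      have "a' \<in> c0"
        unfolding a'_def by (intro c0_diff c0_scaleC unit_vector_c0 that)
      have "norm a' \<le> norm a"
      proof (rule norm_bound)
        fix j show "cmod (apply_bcontfun a' j) \<le> norm a"
          using norm_bounded[of a j]
          by (cases "j = i") (simp_all add: a'_def minus_bcontfun.rep_eq scaleC_bcontfun.rep_eq
              scaleC_complex_def apply_unit_vector z_def)
      qed
      have "a' + a = (2 * z) *\<^sub>C unit_vector i" by (simp add: a'_def)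
      then have "h a' + h a = (2 * z) *\<^sub>C u i"
        using add[OF \<open>a' \<in> c0\<close> that] scale[OF unit_vector_c0, of "2 * z" i] h_unit by simp
      then have "2 * cmod z * norm (u i) = norm (h a' + h a)"
        by (simp add: norm_scaleC norm_mult)
      also have "\<dots> \<le> R * norm a' + norm (h a)"
        using norm_triangle_ineq[of "h a'" "h a"] upper[OF \<open>a' \<in> c0\<close>] by simp
      also have "\<dots> \<le> R * norm a + norm (h a)"
        using \<open>R \<ge> 0\<close> \<open>norm a' \<le> norm a\<close> by (simp add: mult_left_mono)
      finally have "2 * cmod z * norm (u i) \<le> R * norm a + norm (h a)" .
      moreover have "2 * cmod z * r \<le> 2 * cmod z * norm (u i)"
        using u by (intro mult_left_mono) auto
      ultimately show ?thesis by (simp add: z_def mult_ac)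
    qed
    moreover have "r > 0" using \<open>R \<ge> 0\<close> \<open>R < 2 * r\<close> by simp
    ultimately have "norm a \<le> (norm (h a) + R * norm a) / (2 * r)"
      by (intro norm_bound) (simp add: field_simps)
    with \<open>r > 0\<close> show ?thesis
      by (simp add: field_simps)
  qed
  show ?thesis
    using c0_embeds_if_bounded_below[OF add scale upper lower] \<open>R < 2 * r\<close> by simp
qed

text \<open>The theorem of Bessaga and Pelczynski on series with bounded subset sums. Let \<open>\<kappa> n\<close> be the
supremum of the norms of the combinations of the \<open>v k\<close> with \<open>k \<ge> n\<close> and coefficients in the unit
disc; it decreases to some \<open>K \<ge> \<delta> > 0\<close>. From an index \<open>N\<close> with \<open>\<kappa> N < 7/6 K\<close> onwards one chooses
consecutive blocks \<open>u j\<close> of norm above \<open>5/6 K\<close>. A combination of blocks is again a combination of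
the \<open>v k\<close> with \<open>k \<ge> N\<close>, so it is bounded by \<open>7/6 K\<close>, which is less than twice \<open>5/6 K\<close>.\<close>

lemma copy_of_c0_if_bounded_subset_sums:
  fixes v :: "nat \<Rightarrow> 'a::complex_banach"
  assumes C: "\<And>A. finite A \<Longrightarrow> norm (sum v A) \<le> C"
    and \<delta>: "\<And>k. norm (v k) \<ge> \<delta>" "\<delta> > 0"
  shows "contains_copy_of_c0 TYPE('a)"
proof -
  define V where "V n = {norm (\<Sum>k\<in>{n..<p}. a k *\<^sub>C v k) | p a. \<forall>k. cmod (a k) \<le> 1}" for n
  define \<kappa> where "\<kappa> n = Sup (V n)" for n
  have V_bdd: "bdd_above (V n)" for n
    by (rule bdd_aboveI[of _ "4 * C"]) (auto simp: V_def intro!: norm_unit_disc_combination_le C)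
  have \<kappa>_ge: "norm (\<Sum>k\<in>{n..<p}. a k *\<^sub>C v k) \<le> \<kappa> n" if "\<And>k. cmod (a k) \<le> 1" for n p a
    unfolding \<kappa>_def using that by (intro cSup_upper V_bdd) (auto simp: V_def)
  have "\<delta> \<le> \<kappa> n" for n
    using \<kappa>_ge[of "\<lambda>_. 1" n "Suc n"] \<delta>(1)[of n] by (simp add: scaleC_one)
  then have \<kappa>_bdd: "bdd_below (range \<kappa>)"
    by (intro bdd_belowI[of _ \<delta>]) auto
  define K where "K = (INF n. \<kappa> n)"
  have "K \<ge> \<delta>"
    unfolding K_def by (intro cINF_greatest) (auto simp: \<open>\<delta> \<le> \<kappa> _\<close>)
  with \<delta>(2) have "K > 0" by simp
  then have "K < 7 / 6 * K" by simp
  then obtain N where N: "\<kappa> N < 7 / 6 * K"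
    using cInf_lessD[of "range \<kappa>" "7 / 6 * K"] unfolding K_def by blast
  have "\<exists>p a. (\<forall>k. cmod (a k) \<le> 1) \<and> 5 / 6 * K < norm (\<Sum>k\<in>{n..<p}. a k *\<^sub>C v k)" for n
  proof -
    have "5 / 6 * K < \<kappa> n"
      using cINF_lower[OF \<kappa>_bdd, of n] \<open>K > 0\<close> by (simp add: K_def)
    moreover have "V n \<noteq> {}"
      unfolding V_def by (auto intro: exI[of _ "\<lambda>_. 0"])
    ultimately obtain x where "x \<in> V n" "5 / 6 * K < x"
      unfolding \<kappa>_def using less_cSupD by blast
    then show ?thesis
      by (auto simp: V_def)
  qed
  then obtain p \<alpha> where \<alpha>: "\<And>n k. cmod (\<alpha> n k) \<le> 1"
    and p: "\<And>n. 5 / 6 * K < norm (\<Sum>k\<in>{n..<p n}. \<alpha> n k *\<^sub>C v k)"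
    by metis
  have "n < p n" for n
    using p[of n] \<open>K > 0\<close> by (cases "n < p n") auto
  define m where "m j = (p ^^ j) N" for j
  have m: "m 0 = N" "m (Suc j) = p (m j)" for j
    by (simp_all add: m_def)
  have "N \<le> m j" for j
    by (induction j) (use \<open>_ < p _\<close> in \<open>auto simp: m intro: order_trans less_imp_le\<close>)
  define u where "u j = (\<Sum>k\<in>{m j..<m (Suc j)}. \<alpha> (m j) k *\<^sub>C v k)" for j
  have combine: "\<exists>c. (\<forall>k. cmod (c k) \<le> 1) \<and> (\<Sum>j<L. b j *\<^sub>C u j) = (\<Sum>k\<in>{N..<m L}. c k *\<^sub>C v k)"
    if b: "\<And>j. cmod (b j) \<le> 1" for b L
  proof (induction L)
    case 0
    show ?case by (auto simp: m intro: exI[of _ "\<lambda>_. 0"])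
  next
    case (Suc L)
    then obtain c where c: "\<And>k. cmod (c k) \<le> 1"
      "(\<Sum>j<L. b j *\<^sub>C u j) = (\<Sum>k\<in>{N..<m L}. c k *\<^sub>C v k)" by blast
    define c' where "c' k = (if k < m L then c k else b L * \<alpha> (m L) k)" for k
    have "cmod (c' k) \<le> 1" for k
      using b[of L] c(1)[of k] \<alpha>[of "m L" k]
      by (auto simp: c'_def norm_mult intro: mult_le_one)
    moreover have "(\<Sum>j<Suc L. b j *\<^sub>C u j) = (\<Sum>k\<in>{N..<m (Suc L)}. c' k *\<^sub>C v k)"
    proof -
      have "(\<Sum>j<L. b j *\<^sub>C u j) = (\<Sum>k\<in>{N..<m L}. c' k *\<^sub>C v k)"
        unfolding c(2) by (intro sum.cong) (auto simp: c'_def)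
      moreover have "b L *\<^sub>C u L = (\<Sum>k\<in>{m L..<m (Suc L)}. c' k *\<^sub>C v k)"
        unfolding u_def scaleC.scale_sum_right
        by (intro sum.cong) (auto simp: c'_def scaleC_scaleC)
      moreover have "m L \<le> m (Suc L)"
        using \<open>m L < p (m L)\<close> by (simp add: m)
      ultimately show ?thesis
        using sum.atLeastLessThan_concat[OF \<open>N \<le> m L\<close>, of "m (Suc L)"] by simp
    qed
    ultimately show ?case by blast
  qed
  show ?thesis
  proof (rule copy_of_c0_if_bounded_combinations)
    show "5 / 6 * K \<le> norm (u j)" for j
      using p[of "m j"] by (simp add: u_def m)
    show "norm (\<Sum>j<L. b j *\<^sub>C u j) \<le> 7 / 6 * K" if "\<And>j. cmod (b j) \<le> 1" for b L
      using combine[of b L, OF that] \<kappa>_ge[of _ N "m L"] N by (metis less_imp_le order_trans)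
    show "7 / 6 * K < 2 * (5 / 6 * K)"
      using \<open>K > 0\<close> by simp
  qed
qed

section \<open>Power-bounded operators on spaces without a copy of \<open>c\<^sub>0\<close>\<close>

lemma bounded_clinear_imp_bounded_linear:
  assumes "bounded_clinear T"
  shows "bounded_linear T"
proof -
  obtain K where lin: "Vector_Spaces.linear scaleC scaleC T" and K: "\<And>x. norm (T x) \<le> norm x * K"
    using assms by (auto simp: bounded_clinear_def)
  interpret Vector_Spaces.linear scaleC scaleC T by (rule lin)
  show ?thesis
    by (rule bounded_linear_intro[where K = K]) (use K in \<open>simp_all add: add scale flip: scaleC_of_real\<close>)
qed

lemma bounded_linear_funpow:
  fixes T :: "'a::real_normed_vector \<Rightarrow> 'a"
  assumes "bounded_linear T"
  shows "bounded_linear (T ^^ n)"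
proof (induction n)
  case (Suc n)
  then show ?case using bounded_linear_compose[OF assms] by (simp add: o_def)
qed (simp add: id_def bounded_linear_ident)

lemma power_bounded_imp_bounded_powers:
  fixes T :: "'a::complex_normed_vector \<Rightarrow> 'a"
  assumes "bounded_linear T" "power_bounded T"
  obtains M where "bounded_powers T M"
proof -
  obtain B where B: "\<And>n. n \<ge> 1 \<Longrightarrow> onorm (T ^^ n) \<le> B"
    using assms(2) unfolding power_bounded_def bdd_above_def by blast
  have "bounded_powers T (max 1 B)"
  proof (rule bounded_powers.intro)
    show "linear T" by (rule bounded_linear.linear[OF assms(1)])
    fix n and x :: 'a
    show "norm ((T ^^ n) x) \<le> max 1 B * norm x"
    proof (cases "n = 0")
      case True
      then show ?thesis using mult_right_mono[of 1 "max 1 B" "norm x"] by simp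
    next
      case False
      have "norm ((T ^^ n) x) \<le> onorm (T ^^ n) * norm x"
        by (rule onorm[OF bounded_linear_funpow[OF assms(1)]])
      also have "\<dots> \<le> max 1 B * norm x"
        using B[of n] False by (intro mult_right_mono) auto
      finally show ?thesis .
    qed
  qed simp
  then show thesis by (rule that)
qed

lemma power_bounded_belowD:
  assumes "power_bounded_below T" "x \<noteq> 0"
  shows "\<exists>c>0. \<forall>n. c \<le> norm ((T ^^ n) x)"
proof -
  let ?c = "INF n\<in>{1..}. norm ((T ^^ n) x)"
  have "?c > 0" using assms by (simp add: power_bounded_below_def)
  have "bdd_below ((\<lambda>n. norm ((T ^^ n) x)) ` {1..})"
    by (intro bdd_belowI[of _ 0]) auto
  then have le: "?c \<le> norm ((T ^^ n) x)" if "n \<ge> 1" for n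
    using that by (intro cINF_lower) auto
  show ?thesis
  proof (intro exI[of _ "min ?c (norm x)"] conjI allI)
    show "min ?c (norm x) > 0" using \<open>?c > 0\<close> assms(2) by simp
    fix n show "min ?c (norm x) \<le> norm ((T ^^ n) x)"
      using le[of n] by (cases "n = 0") (auto simp: min_le_iff_disj)
  qed
qed

lemma power_bounded_belowI:
  fixes T :: "'a::complex_normed_vector \<Rightarrow> 'a"
  assumes "\<And>x. x \<noteq> 0 \<Longrightarrow> \<exists>c>0. \<forall>n. c \<le> norm ((T ^^ n) x)"
  shows "power_bounded_below T"
  unfolding power_bounded_below_def
proof (intro allI impI)
  fix x :: 'a assume "x \<noteq> 0"
  then obtain c where c: "c > 0" "\<And>n. c \<le> norm ((T ^^ n) x)"
    using assms by blast
  then have "c \<le> (INF n\<in>{1..}. norm ((T ^^ n) x))"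
    by (intro cINF_greatest) auto
  with c(1) show "(INF n\<in>{1..}. norm ((T ^^ n) x)) > 0" by simp
qed

lemma doubly_power_bounded_imp_below:
  fixes T :: "'a::complex_normed_vector \<Rightarrow> 'a"
  assumes "doubly_power_bounded T"
  shows "power_bounded T" "power_bounded_below T"
proof -
  obtain S where S: "bounded_clinear S" "S \<circ> T = id" "power_bounded S" and T: "power_bounded T"
    using assms by (auto simp: doubly_power_bounded_def)
  show "power_bounded T" by (rule T)
  obtain M where "bounded_powers S M"
    using power_bounded_imp_bounded_powers[OF bounded_clinear_imp_bounded_linear[OF S(1)] S(3)] .
  then interpret S: bounded_powers S M .
  have inv: "(S ^^ n) ((T ^^ n) x) = x" for n x
  proof (induction n)
    case (Suc n)
    have "(S ^^ Suc n) ((T ^^ Suc n) x) = (S ^^ n) (S (T ((T ^^ n) x)))"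
      by (simp add: funpow_swap1)
    then show ?case using Suc S(2) by (simp add: fun_eq_iff)
  qed simp
  show "power_bounded_below T"
  proof (rule power_bounded_belowI)
    fix x :: 'a assume "x \<noteq> 0"
    have "norm x / M \<le> norm ((T ^^ n) x)" for n
      using S.norm_funpow_le[of n "(T ^^ n) x"] S.M_pos by (simp add: inv field_simps)
    then show "\<exists>c>0. \<forall>n. c \<le> norm ((T ^^ n) x)"
      using \<open>x \<noteq> 0\<close> S.M_pos by (intro exI[of _ "norm x / M"]) simp
  qed
qed

text \<open>The discrete form of the Bohl--Bohr--Kadets theorem: \<open>T\<^sup>n x = x + \<Sum>i<n. T\<^sup>i (T x - x)\<close> is a
bounded indefinite sum of an almost periodic sequence. If it failed to be almost periodic, the
vectors \<open>v k\<close> of \<open>escaping_vectors_bounded_sums\<close> would produce a copy of \<open>c\<^sub>0\<close>.\<close>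

theorem compact_orbit_if_compact_coboundary:
  fixes T :: "'a::complex_banach \<Rightarrow> 'a"
  assumes "\<not> contains_copy_of_c0 TYPE('a)" "bounded_powers T M"
    and below: "\<And>z. z \<noteq> 0 \<Longrightarrow> \<exists>c>0. \<forall>n. c \<le> norm ((T ^^ n) z)"
    and cpt: "compact (closure (range (\<lambda>n. (T ^^ n) (T x - x))))"
  shows "compact (closure (range (\<lambda>n. (T ^^ n) x)))"
proof (rule ccontr)
  assume "\<not> ?thesis"
  from noncompact_orbit_escapes[OF assms(2) below cpt this]
  obtain \<delta> where "\<delta> > 0"
    "\<And>e. e > 0 \<Longrightarrow> \<exists>s. norm ((T ^^ s) (T x - x) - (T x - x)) < e \<and> norm ((T ^^ s) x - x) \<ge> \<delta>"
    by blast
  from bounded_powers.escaping_vectors_bounded_sums[OF assms(2) this(2)]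
  obtain v :: "nat \<Rightarrow> 'a" where "\<And>k. norm (v k) \<ge> \<delta>"
    "\<And>A. finite A \<Longrightarrow> norm (sum v A) \<le> (M + 1) * norm x + 2" by metis
  then show False
    using copy_of_c0_if_bounded_subset_sums[of v] \<open>\<delta> > 0\<close> assms(1) by blast
qed

text \<open>The orbit under \<open>T\<close> is the union of the images under \<open>T\<^sup>0, \<dots>, T\<^sup>m\<^sup>-\<^sup>1\<close> of the orbit under
\<open>T\<^sup>m\<close>. That one orbit starts at time \<open>1\<close> and the other at time \<open>0\<close> changes it by a single point.\<close>

lemma compact_closure_orbit_iff:
  fixes T :: "'a::real_normed_vector \<Rightarrow> 'a"
  assumes "bounded_linear T" "m \<ge> 1"
  shows "compact (closure {(T ^^ n) y | n. n \<ge> 1}) \<longleftrightarrow> compact (closure (range (\<lambda>n. ((T ^^ m) ^^ n) y)))"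
    (is "compact (closure ?L) \<longleftrightarrow> compact (closure ?R)")
proof
  assume L: "compact (closure ?L)"
  have "((T ^^ m) ^^ n) y \<in> insert y (closure ?L)" for n
  proof (cases "n = 0")
    case False
    then have "((T ^^ m) ^^ n) y \<in> ?L"
      using assms(2) by (auto simp: funpow_mult)
    then show ?thesis by (intro insertI2 subsetD[OF closure_subset])
  qed simp
  then show "compact (closure ?R)"
    by (intro compact_closure_subset[OF compact_insert[OF L]]) auto
next
  assume R: "compact (closure ?R)"
  have "compact (\<Union>j\<in>{..<m}. (T ^^ j) ` closure ?R)"
    by (intro compact_UN compact_continuous_image R finite_lessThan
        bounded_linear.continuous_on[OF bounded_linear_funpow[OF assms(1)]] continuous_on_id)
  then show "compact (closure ?L)"
  proof (rule compact_closure_subset)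
    have "(T ^^ n) y = (T ^^ (n mod m)) (((T ^^ m) ^^ (n div m)) y)" for n
    proof -
      have "(T ^^ (n mod m + m * (n div m))) y = (T ^^ (n mod m)) (((T ^^ m) ^^ (n div m)) y)"
        by (simp only: funpow_add funpow_mult o_apply)
      then show ?thesis by simp
    qed
    moreover have "((T ^^ m) ^^ k) y \<in> closure ?R" for k
      by (intro subsetD[OF closure_subset] rangeI)
    ultimately show "?L \<subseteq> (\<Union>j\<in>{..<m}. (T ^^ j) ` closure ?R)"
      using assms(2) by (auto intro!: bexI[of _ "_ mod m"] image_eqI)
  qed
qed

text \<open>Apply the previous theorem to \<open>S = T\<^sup>m\<close>, for which \<open>S x - x\<close> lies in \<open>rg (I - T\<^sup>m)\<close> for
every \<open>x\<close>. Relative compactness on the range for a single \<open>m\<close> thus spreads to every orbit.\<close>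

theorem all_orbits_compact_if_no_copy_of_c0:
  fixes T :: "'a::complex_banach \<Rightarrow> 'a"
  assumes "\<not> contains_copy_of_c0 TYPE('a)"
    and T: "bounded_linear T" "power_bounded T" "power_bounded_below T"
    and m: "m \<ge> 1" "relatively_compact_orbits_on T (range (\<lambda>x. x - (T ^^ m) x))"
  shows "relatively_compact_orbits_on T F"
proof -
  let ?S = "T ^^ m"
  obtain M where M: "bounded_powers T M"
    using power_bounded_imp_bounded_powers T(1,2) by blast
  interpret T: bounded_powers T M by (rule M)
  have S: "bounded_powers ?S M"
    by (rule bounded_powers.intro)
      (simp_all add: linear_funpow T.linear T.norm_funpow_le T.M_ge_1 funpow_mult)
  have below: "\<exists>c>0. \<forall>n. c \<le> norm ((?S ^^ n) z)" if "z \<noteq> 0" for z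
    using power_bounded_belowD[OF T(3) that] by (simp add: funpow_mult) blast
  have "compact (closure (range (\<lambda>n. (?S ^^ n) x)))" for x
  proof (rule compact_orbit_if_compact_coboundary[OF assms(1) S below])
    have "?S x - x = (- x) - ?S (- x)"
      by (simp add: linear_neg[OF linear_funpow[OF T.linear]])
    then show "compact (closure (range (\<lambda>n. (?S ^^ n) (?S x - x))))"
      using m(2) unfolding relatively_compact_orbits_on_def compact_closure_orbit_iff[OF T(1) m(1)]
      by (metis rangeI)
  qed
  then show ?thesis
    unfolding relatively_compact_orbits_on_def compact_closure_orbit_iff[OF T(1) m(1)] by blast
qed

section \<open>The Hahn--Banach theorem\<close>

text \<open>Homogeneity is demanded as an inequality only; applied to \<open>t\<close> and to \<open>1/t\<close> it yields
equality.\<close>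

definition sublinear :: "('a::real_vector \<Rightarrow> real) \<Rightarrow> bool"
  where "sublinear p \<longleftrightarrow> (\<forall>x y. p (x + y) \<le> p x + p y) \<and> (\<forall>t>0. \<forall>x. p (t *\<^sub>R x) \<le> t * p x)"

lemma sublinear_add: "sublinear p \<Longrightarrow> p (x + y) \<le> p x + p y"
  by (simp add: sublinear_def)

lemma sublinear_scale:
  assumes "sublinear p" "t > 0"
  shows "p (t *\<^sub>R x) = t * p x"
proof (rule antisym)
  show "p (t *\<^sub>R x) \<le> t * p x" using assms by (simp add: sublinear_def)
  have "p (inverse t *\<^sub>R t *\<^sub>R x) \<le> inverse t * p (t *\<^sub>R x)"
    using assms unfolding sublinear_def by (metis inverse_positive_iff_positive)
  then show "t * p x \<le> p (t *\<^sub>R x)"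
    using \<open>t > 0\<close> by (simp add: field_simps)
qed

lemma sublinear_0: "sublinear p \<Longrightarrow> p 0 = 0"
  using sublinear_scale[of p 2 0] by simp

lemma sublinear_ge: "sublinear p \<Longrightarrow> - p (- x) \<le> p x"
  using sublinear_add[of p x "- x"] by (simp add: sublinear_0)

text \<open>The common source of the three sublinear functionals below: an infimum is sublinear as soon
as the index set absorbs sums and positive multiples.\<close>

lemma sublinear_INF:
  fixes g :: "'i \<Rightarrow> 'a::real_vector \<Rightarrow> real"
  assumes "I \<noteq> {}" and bdd: "\<And>x. bdd_below ((\<lambda>i. g i x) ` I)"
    and add: "\<And>i j x y. i \<in> I \<Longrightarrow> j \<in> I \<Longrightarrow> \<exists>k\<in>I. g k (x + y) \<le> g i x + g j y"
    and scale: "\<And>i t x. i \<in> I \<Longrightarrow> t > 0 \<Longrightarrow> \<exists>k\<in>I. g k (t *\<^sub>R x) \<le> t * g i x"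
  shows "sublinear (\<lambda>x. INF i\<in>I. g i x)"
  unfolding sublinear_def
proof (intro conjI allI impI)
  let ?p = "\<lambda>x. INF i\<in>I. g i x"
  have le: "?p x \<le> c" if "\<exists>k\<in>I. g k x \<le> c" for x c
    using that cINF_lower2[OF bdd] by blast
  show "?p (x + y) \<le> ?p x + ?p y" for x y
  proof -
    have "?p (x + y) - g i x \<le> ?p y" if "i \<in> I" for i
      using \<open>I \<noteq> {}\<close> by (rule cINF_greatest) (use le[OF add[OF that]] in \<open>simp add: algebra_simps\<close>)
    then have "?p (x + y) - ?p y \<le> ?p x"
      using \<open>I \<noteq> {}\<close> by (intro cINF_greatest) (simp_all add: algebra_simps)
    then show ?thesis by simp
  qed
  show "?p (t *\<^sub>R x) \<le> t * ?p x" if "t > 0" for t x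
  proof -
    have "?p (t *\<^sub>R x) / t \<le> ?p x"
      using \<open>I \<noteq> {}\<close>
      by (rule cINF_greatest) (use le[OF scale[OF _ that]] that in \<open>simp add: field_simps\<close>)
    then show ?thesis using that by (simp add: field_simps)
  qed
qed

text \<open>Decreasing \<open>p\<close> in the direction of \<open>y\<close> to the infimum of \<open>p (x + t y) - t p y\<close> over \<open>t \<ge> 0\<close>
gives a sublinear functional below \<open>p\<close>, hence \<open>p\<close> itself by minimality. At \<open>t = 1\<close> this is
superadditivity.\<close>

lemma minimal_sublinear_imp_linear:
  fixes p :: "'a::real_vector \<Rightarrow> real"
  assumes p: "sublinear p" and min: "\<And>q. sublinear q \<Longrightarrow> q \<le> p \<Longrightarrow> q = p"
  shows "linear p"
proof -
  have ge: "p x + p y \<le> p (x + y)" for x y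
  proof -
    define g where "g t x = p (x + t *\<^sub>R y) - t * p y" for t x
    have scale: "p (t *\<^sub>R y) = t * p y" if "t \<ge> 0" for t
      using that sublinear_scale[OF p, of t y] sublinear_0[OF p] by (cases "t = 0") auto
    have bdd: "bdd_below ((\<lambda>t. g t x) ` {0..})" for x
    proof (rule bdd_belowI2)
      fix t :: real assume "t \<in> {0..}"
      then show "- p (- x) \<le> g t x"
        using sublinear_add[OF p, of "x + t *\<^sub>R y" "- x"] scale[of t] by (simp add: g_def)
    qed
    have "sublinear (\<lambda>x. INF t\<in>{0..}. g t x)"
    proof (rule sublinear_INF[OF _ bdd])
      fix s t :: real and x x' assume "s \<in> {0..}" "t \<in> {0..}"
      moreover have "g (s + t) (x + x') \<le> g s x + g t x'"
        using sublinear_add[OF p, of "x + s *\<^sub>R y" "x' + t *\<^sub>R y"]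
        by (simp add: g_def algebra_simps)
      ultimately show "\<exists>k\<in>{0..}. g k (x + x') \<le> g s x + g t x'"
        by (intro bexI[of _ "s + t"]) auto
    next
      fix s t :: real and x assume "s \<in> {0..}" "t > 0"
      moreover have "g (t * s) (t *\<^sub>R x) = t * g s x"
        using sublinear_scale[OF p \<open>t > 0\<close>, of "x + s *\<^sub>R y"] by (simp add: g_def algebra_simps)
      ultimately show "\<exists>k\<in>{0..}. g k (t *\<^sub>R x) \<le> t * g s x"
        by (intro bexI[of _ "t * s"]) auto
    qed auto
    moreover have "(INF t\<in>{0..}. g t x) \<le> p x" for x
      by (rule cINF_lower2[OF bdd, of 0]) (auto simp: g_def)
    ultimately have "(\<lambda>x. INF t\<in>{0..}. g t x) = p"
      by (intro min le_funI)
    then have "p x = (INF t\<in>{0..}. g t x)" by metis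
    also have "\<dots> \<le> g 1 x"
      by (rule cINF_lower[OF bdd]) auto
    finally show ?thesis by (simp add: g_def)
  qed
  have add: "p (x + y) = p x + p y" for x y
    using ge sublinear_add[OF p] by (rule antisym[rotated])
  have neg: "p (- x) = - p x" for x
    using add[of x "- x"] sublinear_0[OF p] by simp
  show ?thesis
  proof (rule linearI)
    fix t :: real and x
    have "p (t *\<^sub>R x) = - (- t * p x)" if "t < 0"
      using sublinear_scale[OF p, of "- t" x] neg[of "t *\<^sub>R x"] that by simp
    then show "p (t *\<^sub>R x) = t *\<^sub>R p x"
      using sublinear_scale[OF p, of t x] sublinear_0[OF p] by (cases t "0 :: real" rule: linorder_cases) auto
  qed (rule add)
qed

text \<open>By Zorn's lemma: the infimum over a chain is again sublinear, and it is finite since every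
member \<open>q\<close> of the chain satisfies \<open>q x \<ge> - p (- x)\<close>.\<close>

lemma linear_minorant_exists:
  fixes p :: "'a::real_vector \<Rightarrow> real"
  assumes p: "sublinear p"
  shows "\<exists>u. linear u \<and> u \<le> p"
proof -
  let ?A = "{q. sublinear q \<and> q \<le> p}"
  have "\<exists>m\<in>?A. \<forall>a\<in>?A. a \<le> m \<longrightarrow> a = m"
  proof (rule predicate_Zorn)
    show "partial_order_on ?A (relation_of (\<lambda>q r. r \<le> q) ?A)"
      by (rule partial_order_on_relation_ofI) auto
    fix C assume C: "C \<in> Chains (relation_of (\<lambda>q r. r \<le> q) ?A)"
    have CA: "sublinear q" "q \<le> p" if "q \<in> C" for q
      using C that by (auto simp: Chains_def relation_of_def)
    have total: "q \<le> r \<or> r \<le> q" if "q \<in> C" "r \<in> C" for q r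
      using C that by (auto simp: Chains_def relation_of_def)
    show "\<exists>u\<in>?A. \<forall>a\<in>C. u \<le> a"
    proof (cases "C = {}")
      case True
      then show ?thesis using p by blast
    next
      case False
      have bdd: "bdd_below ((\<lambda>q. q x) ` C)" for x
      proof (rule bdd_belowI2)
        fix q assume "q \<in> C"
        then show "- p (- x) \<le> q x"
          using sublinear_ge[OF CA(1), of q x] le_funD[OF CA(2), of q "- x"] by simp
      qed
      have "sublinear (\<lambda>x. INF q\<in>C. q x)"
      proof (rule sublinear_INF[OF False bdd])
        fix q r :: "'a \<Rightarrow> real" and x y assume qr: "q \<in> C" "r \<in> C"
        have "q (x + y) \<le> q x + q y" "r (x + y) \<le> r x + r y"
          using CA(1) qr sublinear_add by blast+
        then have "q (x + y) \<le> q x + r y \<or> r (x + y) \<le> q x + r y"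
          using total[OF qr] by (smt (verit) le_fun_def)
        then show "\<exists>k\<in>C. k (x + y) \<le> q x + r y" using qr by blast
      next
        fix q :: "'a \<Rightarrow> real" and t :: real and x assume "q \<in> C" "t > 0"
        then show "\<exists>k\<in>C. k (t *\<^sub>R x) \<le> t * q x"
          using sublinear_scale[OF CA(1)] by (intro bexI[of _ q]) auto
      qed
      moreover have le: "(\<lambda>x. INF q\<in>C. q x) \<le> r" if "r \<in> C" for r
        by (intro le_funI cINF_lower bdd that)
      moreover obtain r where "r \<in> C" using False by blast
      ultimately show ?thesis
        using CA(2) by (intro bexI[of _ "\<lambda>x. INF q\<in>C. q x"]) (auto intro: order_trans)
    qed
  qed
  then obtain m where m: "sublinear m" "m \<le> p" "\<And>a. sublinear a \<Longrightarrow> a \<le> p \<Longrightarrow> a \<le> m \<Longrightarrow> a = m"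
    by blast
  then have "linear m"
    by (intro minimal_sublinear_imp_linear) (auto intro: order_trans)
  with m(2) show ?thesis by blast
qed

text \<open>The infimum of \<open>f y + M \<parallel>x - y\<parallel>\<close> over \<open>y \<in> F\<close> is the largest sublinear functional below
\<open>M \<parallel>\<cdot>\<parallel>\<close> that does not exceed \<open>f\<close> on \<open>F\<close>. A linear minorant \<open>u\<close> of it satisfies \<open>u \<le> f\<close> on the
subspace \<open>F\<close>, and by linearity \<open>u = f\<close> there.\<close>

theorem hahn_banach_real:
  fixes f :: "'a::real_normed_vector \<Rightarrow> real"
  assumes F: "subspace F"
    and add: "\<And>x y. x \<in> F \<Longrightarrow> y \<in> F \<Longrightarrow> f (x + y) = f x + f y"
    and scale: "\<And>t x. x \<in> F \<Longrightarrow> f (t *\<^sub>R x) = t * f x"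
    and le: "\<And>x. x \<in> F \<Longrightarrow> f x \<le> M * norm x" and "M \<ge> 0"
  shows "\<exists>u. linear u \<and> (\<forall>x\<in>F. u x = f x) \<and> (\<forall>x. \<bar>u x\<bar> \<le> M * norm x)"
proof -
  define g where "g y x = f y + M * norm (x - y)" for y x
  have f0: "f 0 = 0" using scale[OF subspace_0[OF F], of 0] by simp
  have bdd: "bdd_below ((\<lambda>y. g y x) ` F)" for x
  proof (rule bdd_belowI2)
    fix y assume "y \<in> F"
    have "- f y \<le> M * norm y"
      using le[of "- y"] scale[OF \<open>y \<in> F\<close>, of "- 1"] subspace_neg[OF F \<open>y \<in> F\<close>] by simp
    also have "\<dots> \<le> M * (norm (x - y) + norm x)"
      using norm_triangle_ineq4[of x "x - y"] \<open>M \<ge> 0\<close> by (intro mult_left_mono) auto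
    finally show "- M * norm x \<le> g y x"
      by (simp add: g_def algebra_simps)
  qed
  have "sublinear (\<lambda>x. INF y\<in>F. g y x)"
  proof (rule sublinear_INF[OF _ bdd])
    fix y z x x' assume yz: "y \<in> F" "z \<in> F"
    have "M * norm ((x + x') - (y + z)) \<le> M * (norm (x - y) + norm (x' - z))"
      using norm_triangle_ineq[of "x - y" "x' - z"] \<open>M \<ge> 0\<close>
      by (intro mult_left_mono) (auto simp: algebra_simps)
    then show "\<exists>k\<in>F. g k (x + x') \<le> g y x + g z x'"
      using yz by (intro bexI[of _ "y + z"] subspace_add[OF F]) (auto simp: g_def add algebra_simps)
  next
    fix y x and t :: real assume "y \<in> F" "t > 0"
    have "norm (t *\<^sub>R x - t *\<^sub>R y) = t * norm (x - y)"
      using \<open>t > 0\<close> by (simp flip: scaleR_right_diff_distrib)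
    with \<open>y \<in> F\<close> show "\<exists>k\<in>F. g k (t *\<^sub>R x) \<le> t * g y x"
      by (intro bexI[of _ "t *\<^sub>R y"] subspace_scale[OF F]) (auto simp: g_def scale algebra_simps)
  qed (use subspace_0[OF F] in blast)
  then obtain u where u: "linear u" "u \<le> (\<lambda>x. INF y\<in>F. g y x)"
    using linear_minorant_exists by blast
  have u_le: "u x \<le> g y x" if "y \<in> F" for x y
    using le_funD[OF u(2), of x] cINF_lower[OF bdd that, of x] by linarith
  have bound: "u x \<le> M * norm x" for x
    using u_le[OF subspace_0[OF F], of x] by (simp add: g_def f0)
  have "u x = f x" if "x \<in> F" for x
  proof (rule antisym)
    show "u x \<le> f x" using u_le[OF that, of x] by (simp add: g_def)
    show "f x \<le> u x"
      using u_le[OF subspace_neg[OF F that], of "- x"] scale[OF that, of "- 1"]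
      by (simp add: g_def linear_neg[OF u(1)])
  qed
  moreover have "\<bar>u x\<bar> \<le> M * norm x" for x
    using bound[of x] bound[of "- x"] by (simp add: linear_neg[OF u(1)])
  ultimately show ?thesis using u(1) by blast
qed

lemma bounded_clinearI:
  assumes "\<And>x y. T (x + y) = T x + T y" "\<And>c x. T (c *\<^sub>C x) = c *\<^sub>C T x"
    "\<And>x. norm (T x) \<le> K * norm x"
  shows "bounded_clinear T"
  unfolding bounded_clinear_def
proof (intro conjI exI[of _ K] allI)
  show "Vector_Spaces.linear scaleC scaleC T"
    by unfold_locales (use assms in \<open>auto simp: scaleC_add_left scaleC_add_right scaleC_scaleC scaleC_one\<close>)
qed (use assms(3) in \<open>simp add: mult.commute\<close>)

lemma bounded_clinear_add: "bounded_clinear T \<Longrightarrow> T (x + y) = T x + T y"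
  by (simp add: bounded_clinear_imp_bounded_linear bounded_linear.linear linear_add)

lemma bounded_clinear_scaleC: "bounded_clinear T \<Longrightarrow> T (c *\<^sub>C x) = c *\<^sub>C T x"
  by (simp add: bounded_clinear_def module_hom.scale Vector_Spaces.linear_iff_module_hom)

lemma bounded_clinear_diff: "bounded_clinear T \<Longrightarrow> T (x - y) = T x - T y"
  by (simp add: bounded_clinear_imp_bounded_linear bounded_linear.linear linear_diff)

text \<open>A complex functional is determined by its real part \<open>u\<close> through \<open>g x = u x - \<i> u (\<i> x)\<close>.
Estimating the two parts separately costs a factor \<open>2\<close>, which is harmless for what follows.\<close>

theorem hahn_banach_complex:
  fixes f :: "'a::complex_normed_vector \<Rightarrow> complex"
  assumes F: "scaleC.subspace F"
    and add: "\<And>x y. x \<in> F \<Longrightarrow> y \<in> F \<Longrightarrow> f (x + y) = f x + f y"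
    and scale: "\<And>c x. x \<in> F \<Longrightarrow> f (c *\<^sub>C x) = c * f x"
    and le: "\<And>x. x \<in> F \<Longrightarrow> cmod (f x) \<le> M * norm x" and "M \<ge> 0"
  shows "\<exists>g. bounded_clinear g \<and> (\<forall>x\<in>F. g x = f x) \<and> (\<forall>x. cmod (g x) \<le> 2 * M * norm x)"
proof -
  have "subspace F"
    using F by (auto simp: subspace_def scaleC.subspace_def simp flip: scaleC_of_real)
  moreover have "Re (f x) \<le> M * norm x" if "x \<in> F" for x
    using le[OF that] complex_Re_le_cmod order_trans by blast
  ultimately have "\<exists>u. linear u \<and> (\<forall>x\<in>F. u x = Re (f x)) \<and> (\<forall>x. \<bar>u x\<bar> \<le> M * norm x)"
    using \<open>M \<ge> 0\<close> by (intro hahn_banach_real) (auto simp: add scale simp flip: scaleC_of_real)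
  then obtain u where u: "linear u" "\<And>x. x \<in> F \<Longrightarrow> u x = Re (f x)" "\<And>x. \<bar>u x\<bar> \<le> M * norm x"
    by blast
  define g where "g x = Complex (u x) (- u (\<i> *\<^sub>C x))" for x
  have g_add: "g (x + y) = g x + g y" for x y
    by (simp add: g_def complex_eq_iff scaleC_add_right linear_add[OF u(1)])
  have u_scale: "u (of_real t *\<^sub>C x) = t * u x" for t x
    using linear_scale[OF u(1), of t x] by (simp add: scaleC_of_real)
  have g_real: "g (of_real t *\<^sub>C x) = of_real t * g x" for t x
    using u_scale[of t x] u_scale[of t "\<i> *\<^sub>C x"]
    by (simp add: g_def complex_eq_iff scaleC_scaleC mult.commute)
  have g_i: "g (\<i> *\<^sub>C x) = \<i> * g x" for x
    using u_scale[of "- 1" x] by (simp add: g_def complex_eq_iff scaleC_scaleC)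
  have g_scale: "g (c *\<^sub>C x) = c * g x" for c x
  proof -
    have "c *\<^sub>C x = of_real (Re c) *\<^sub>C x + \<i> *\<^sub>C (of_real (Im c) *\<^sub>C x)"
      by (simp only: scaleC_scaleC scaleC_add_left[symmetric] complex_eq[symmetric])
    then have "g (c *\<^sub>C x) = of_real (Re c) * g x + \<i> * (of_real (Im c) * g x)"
      by (simp only: g_add g_real g_i)
    also have "\<dots> = (of_real (Re c) + \<i> * of_real (Im c)) * g x"
      by (simp add: algebra_simps)
    finally show ?thesis by (simp only: complex_eq[symmetric])
  qed
  have bound: "cmod (g x) \<le> 2 * M * norm x" for x
  proof -
    have "cmod (g x) \<le> \<bar>u x\<bar> + \<bar>u (\<i> *\<^sub>C x)\<bar>"
      using cmod_le[of "g x"] by (simp add: g_def)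
    with u(3)[of x] u(3)[of "\<i> *\<^sub>C x"] show ?thesis by (simp add: norm_scaleC)
  qed
  have "g x = f x" if "x \<in> F" for x
  proof -
    have "\<i> *\<^sub>C x \<in> F" using F that by (simp add: scaleC.subspace_def)
    then show ?thesis
      using u(2)[OF that] u(2)[of "\<i> *\<^sub>C x"] scale[OF that, of \<i>] by (simp add: g_def complex_eq_iff)
  qed
  moreover have "bounded_clinear g"
    using g_add g_scale bound by (intro bounded_clinearI) (auto simp: scaleC_complex_def)
  ultimately show ?thesis using bound by blast
qed

section \<open>Complementation of \<open>c\<^sub>0\<close> in separable spaces\<close>

lemma convergent_if_convergent_on_dense:
  fixes f :: "nat \<Rightarrow> 'a::real_normed_vector \<Rightarrow> 'b::banach"
  assumes lip: "\<And>n x y. norm (f n x - f n y) \<le> K * norm (x - y)" and "K > 0"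
    and dense: "closure D = UNIV"
    and conv: "\<And>x. x \<in> D \<Longrightarrow> convergent (\<lambda>n. f n x)"
  shows "convergent (\<lambda>n. f n x)"
proof (rule Cauchy_convergent, rule CauchyI)
  fix e :: real assume "e > 0"
  then have "e / (3 * K) > 0" using \<open>K > 0\<close> by simp
  then obtain d where d: "d \<in> D" "norm (x - d) < e / (3 * K)"
    using closure_approachable[of x D] dense by (auto simp: dist_norm norm_minus_commute)
  then have K: "K * norm (x - d) < e / 3"
    using \<open>K > 0\<close> by (simp add: field_simps)
  obtain N where N: "\<And>m n. m \<ge> N \<Longrightarrow> n \<ge> N \<Longrightarrow> norm (f m d - f n d) < e / 3"
    using CauchyD[OF convergent_Cauchy[OF conv[OF d(1)]], of "e / 3"] \<open>e > 0\<close> by auto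
  have "norm (f m x - f n x) < e" if "m \<ge> N" "n \<ge> N" for m n
  proof -
    have "f m x - f n x = (f m x - f m d) + (f m d - f n d) - (f n x - f n d)" by simp
    then have "norm (f m x - f n x) \<le> norm (f m x - f m d) + norm (f m d - f n d) + norm (f n x - f n d)"
      using norm_triangle_ineq4[of "(f m x - f m d) + (f m d - f n d)" "f n x - f n d"]
        norm_triangle_ineq[of "f m x - f m d" "f m d - f n d"] by simp
    with lip[of m x d] lip[of n x d] N[OF that] K show ?thesis by linarith
  qed
  then show "\<exists>M. \<forall>m\<ge>M. \<forall>n\<ge>M. norm (f m x - f n x) < e" by blast
qed

lemma tendsto_0_if_tendsto_0_on_dense:
  fixes f :: "nat \<Rightarrow> 'a::real_normed_vector \<Rightarrow> 'b::banach"
  assumes lip: "\<And>n x y. norm (f n x - f n y) \<le> K * norm (x - y)" and "K > 0"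
    and dense: "closure D = UNIV"
    and conv: "\<And>x. x \<in> D \<Longrightarrow> (\<lambda>n. f n x) \<longlonglongrightarrow> 0"
  shows "(\<lambda>n. f n x) \<longlonglongrightarrow> 0"
proof (rule LIMSEQ_I)
  fix e :: real assume "e > 0"
  then have "e / (2 * K) > 0" using \<open>K > 0\<close> by simp
  then obtain d where d: "d \<in> D" "norm (x - d) < e / (2 * K)"
    using closure_approachable[of x D] dense by (auto simp: dist_norm norm_minus_commute)
  then have K: "K * norm (x - d) < e / 2"
    using \<open>K > 0\<close> by (simp add: field_simps)
  obtain N where N: "\<And>n. n \<ge> N \<Longrightarrow> norm (f n d) < e / 2"
    using LIMSEQ_D[OF conv[OF d(1)], of "e / 2"] \<open>e > 0\<close> by auto
  have "norm (f n x - 0) < e" if "n \<ge> N" for n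
    using lip[of n x d] N[OF that] K norm_triangle_ineq[of "f n x - f n d" "f n d"] by simp
  then show "\<exists>N. \<forall>n\<ge>N. norm (f n x - 0) < e" by blast
qed

text \<open>The sequential Banach--Alaoglu theorem for a separable space: a diagonal sequence converges
on the dense set, hence everywhere by equicontinuity.\<close>

lemma bounded_functionals_subsequence:
  fixes f :: "nat \<Rightarrow> 'a::complex_normed_vector \<Rightarrow> complex" and D :: "'a set"
  assumes D: "countable D" "closure D = UNIV"
    and f: "\<And>n. bounded_clinear (f n)" and bound: "\<And>n x. cmod (f n x) \<le> M * norm x" and "M > 0"
  obtains r g where "strict_mono r" "bounded_clinear g" "\<And>x. cmod (g x) \<le> M * norm x"
    "\<And>x. (\<lambda>n. f (r n) x) \<longlonglongrightarrow> g x"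
proof -
  \<comment> \<open>Dividing by \<open>\<theta> x\<close> turns the pointwise bound into a uniform one, as the selection lemma requires.\<close>
  define \<theta> where "\<theta> x = complex_of_real (M * norm x + 1)" for x :: 'a
  have \<theta>: "cmod (\<theta> x) = M * norm x + 1" "\<theta> x \<noteq> 0" for x
  proof -
    have "M * norm x + 1 > 0" using \<open>M > 0\<close> by (simp add: add_nonneg_pos)
    then show *: "cmod (\<theta> x) = M * norm x + 1"
      unfolding \<theta>_def norm_of_real by linarith
    with \<open>M * norm x + 1 > 0\<close> show "\<theta> x \<noteq> 0" by auto
  qed
  have "cmod (f n x / \<theta> x) \<le> 1" for n x
    using bound[of n x] \<open>M > 0\<close> by (simp add: norm_divide \<theta>(1) divide_le_eq add_nonneg_pos)
  then obtain r where r: "strict_mono (r :: nat \<Rightarrow> nat)"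
    "\<And>x. x \<in> D \<Longrightarrow> \<exists>l. (\<lambda>n. f (r n) x / \<theta> x) \<longlonglongrightarrow> l"
    using function_convergent_subsequence[OF D(1), of "\<lambda>n x. f n x / \<theta> x" 1, OF \<open>cmod (f _ _ / \<theta> _) \<le> 1\<close>] by metis
  have lip: "cmod (f n x - f n y) \<le> M * norm (x - y)" for n x y
    using bound[of n "x - y"] by (simp add: bounded_clinear_diff[OF f])
  have "convergent (\<lambda>n. f (r n) x)" for x
  proof (rule convergent_if_convergent_on_dense[OF lip \<open>M > 0\<close> D(2)])
    fix x assume "x \<in> D"
    then obtain l where "(\<lambda>n. f (r n) x / \<theta> x) \<longlonglongrightarrow> l" using r(2) by blast
    from tendsto_mult_left[OF this, of "\<theta> x"] show "convergent (\<lambda>n. f (r n) x)"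
      using \<theta>(2)[of x] by (auto simp: convergent_def)
  qed
  then obtain g where g: "\<And>x. (\<lambda>n. f (r n) x) \<longlonglongrightarrow> g x"
    unfolding convergent_def by metis
  have g_bound: "cmod (g x) \<le> M * norm x" for x
    using bound by (intro tendsto_upperbound[OF tendsto_norm[OF g]]) auto
  have "bounded_clinear g"
  proof (rule bounded_clinearI[OF _ _ g_bound])
    show "g (x + y) = g x + g y" for x y
      using tendsto_add[OF g g, of x y] g[of "x + y"]
      by (simp add: bounded_clinear_add[OF f] LIMSEQ_unique)
    show "g (c *\<^sub>C x) = c *\<^sub>C g x" for c x
      using tendsto_mult_left[OF g, of c x] g[of "c *\<^sub>C x"]
      by (simp add: bounded_clinear_scaleC[OF f] scaleC_complex_def LIMSEQ_unique)
  qed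
  with r(1) g_bound g show thesis using that by blast
qed

text \<open>The choice at stage \<open>n\<close> realises the best quality \<open>j \<le> n\<close> that is available at this stage.\<close>

lemma diagonal_choice:
  fixes P :: "nat \<Rightarrow> nat \<Rightarrow> 'a \<Rightarrow> bool"
  assumes "G \<noteq> {}" and mono: "\<And>n i j \<gamma>. i \<le> j \<Longrightarrow> P n j \<gamma> \<Longrightarrow> P n i \<gamma>"
    and ex: "\<And>j. \<forall>\<^sub>F n in sequentially. \<exists>\<gamma>\<in>G. P n j \<gamma>"
  shows "\<exists>\<gamma>. (\<forall>n. \<gamma> n \<in> G) \<and> (\<forall>j. \<forall>\<^sub>F n in sequentially. P n j (\<gamma> n))"
proof -
  have "\<exists>\<gamma>\<in>G. \<forall>j\<le>n. (\<exists>\<beta>\<in>G. P n j \<beta>) \<longrightarrow> P n j \<gamma>" for n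
  proof (cases "\<exists>j\<le>n. \<exists>\<beta>\<in>G. P n j \<beta>")
    case True
    let ?J = "{j. j \<le> n \<and> (\<exists>\<beta>\<in>G. P n j \<beta>)}"
    have "finite ?J" "?J \<noteq> {}" using True by auto
    then have "Max ?J \<in> ?J" and Max: "\<And>j. j \<in> ?J \<Longrightarrow> j \<le> Max ?J"
      by (rule Max_in, intro Max_ge) auto
    then obtain \<gamma> where \<gamma>: "\<gamma> \<in> G" "P n (Max ?J) \<gamma>" by blast
    have "P n j \<gamma>" if "j \<le> n" "\<exists>\<beta>\<in>G. P n j \<beta>" for j
      by (rule mono[OF Max \<gamma>(2)]) (use that in blast)
    with \<gamma>(1) show ?thesis by blast
  next
    case False
    then show ?thesis using \<open>G \<noteq> {}\<close> by blast
  qed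
  then obtain \<gamma> where \<gamma>: "\<And>n. \<gamma> n \<in> G" "\<And>n j. j \<le> n \<Longrightarrow> \<exists>\<beta>\<in>G. P n j \<beta> \<Longrightarrow> P n j (\<gamma> n)"
    by metis
  moreover have "\<forall>\<^sub>F n in sequentially. P n j (\<gamma> n)" for j
    using ex[of j] eventually_ge_at_top[of j] by eventually_elim (rule \<gamma>(2))
  ultimately show ?thesis by blast
qed

text \<open>Sobczyk's theorem, by the argument of Veech: the entries of \<open>h\<inverse>\<close> extend from the copy \<open>F\<close> of
\<open>c\<^sub>0\<close> to uniformly bounded functionals \<open>f n\<close> on the whole space. Every pointwise limit of a
subsequence of \<open>f n\<close> vanishes on \<open>F\<close>, because the entries of an element of \<open>c\<^sub>0\<close> tend to \<open>0\<close>. By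
compactness, \<open>f n\<close> therefore approaches the set \<open>G\<close> of bounded functionals that vanish on \<open>F\<close>.
Subtracting functionals \<open>\<gamma> n \<in> G\<close> that come close to \<open>f n\<close> produces functionals \<open>\<phi> n\<close> that tend to
\<open>0\<close> everywhere and still read off the entries. Thus \<open>x \<mapsto> h (\<phi> n x)\<^sub>n\<close> is a projection onto \<open>F\<close>,
which is bounded if \<open>h\<close> is.\<close>

theorem sobczyk:
  fixes h :: "(nat, complex) bcontfun \<Rightarrow> 'a::complex_banach"
  assumes sep: "separable_space (euclidean :: 'a topology)"
    and F: "scaleC.subspace (h ` c0)"
    and add: "\<And>a b. a \<in> c0 \<Longrightarrow> b \<in> c0 \<Longrightarrow> h (a + b) = h a + h b"
    and scale: "\<And>c a. a \<in> c0 \<Longrightarrow> h (c *\<^sub>C a) = c *\<^sub>C h a"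
    and below: "\<And>a. a \<in> c0 \<Longrightarrow> norm a \<le> B * norm (h a)" and "B > 0"
  obtains \<phi> C where "\<And>n. bounded_clinear (\<phi> n)" "C > 0" "\<And>n x. cmod (\<phi> n x) \<le> C * norm x"
    "\<And>x. (\<lambda>n. \<phi> n x) \<longlonglongrightarrow> 0" "\<And>n a. a \<in> c0 \<Longrightarrow> \<phi> n (h a) = apply_bcontfun a n"
proof -
  let ?F = "h ` c0"
  have inj: "inj_on h c0"
  proof (rule inj_onI)
    fix a b assume ab: "a \<in> c0" "b \<in> c0" "h a = h b"
    have "h (a - b) + h b = h a" using add[OF c0_diff[OF ab(1,2)] ab(2)] by simp
    then show "a = b" using below[OF c0_diff[OF ab(1,2)]] ab(3) by simp
  qed
  define g where "g = the_inv_into c0 h"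
  have gh: "g (h a) = a" if "a \<in> c0" for a
    unfolding g_def by (rule the_inv_into_f_f[OF inj that])
  have "\<exists>f. bounded_clinear f \<and> (\<forall>x\<in>?F. f x = apply_bcontfun (g x) n) \<and> (\<forall>x. cmod (f x) \<le> 2 * B * norm x)" for n
  proof (rule hahn_banach_complex[OF F])
    fix x y assume "x \<in> ?F" "y \<in> ?F"
    then obtain a b where ab: "a \<in> c0" "b \<in> c0" "x = h a" "y = h b" by blast
    then show "apply_bcontfun (g (x + y)) n = apply_bcontfun (g x) n + apply_bcontfun (g y) n"
      using gh[OF c0_add[OF ab(1,2)]] by (simp add: add gh plus_bcontfun.rep_eq)
    show "apply_bcontfun (g (c *\<^sub>C x)) n = c * apply_bcontfun (g x) n" for c
      using gh[OF c0_scaleC[OF ab(1)], of c] ab by (simp add: scale gh scaleC_bcontfun.rep_eq scaleC_complex_def)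
    show "cmod (apply_bcontfun (g x) n) \<le> B * norm x"
      using ab below[OF ab(1)] norm_bounded[of a n] by (simp add: gh)
  qed (use \<open>B > 0\<close> in simp)
  then obtain f where f: "\<And>n. bounded_clinear (f n)" "\<And>n x. cmod (f n x) \<le> 2 * B * norm x"
    "\<And>n x. x \<in> ?F \<Longrightarrow> f n x = apply_bcontfun (g x) n"
    by metis
  have fh: "f n (h a) = apply_bcontfun a n" if "a \<in> c0" for n a
    using f(3)[of "h a"] that by (simp add: gh)
  let ?M = "2 * B"
  have "?M > 0" using \<open>B > 0\<close> by simp
  obtain D :: "'a set" where D: "countable D" "closure D = UNIV"
    using sep by (auto simp: separable_space_def)
  then have "D \<noteq> {}" by auto
  define d where "d = from_nat_into D"
  have d: "range d = D" unfolding d_def using \<open>D \<noteq> {}\<close> D(1) by (rule range_from_nat_into)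
  define G where "G = {\<gamma>. bounded_clinear \<gamma> \<and> (\<forall>x. cmod (\<gamma> x) \<le> ?M * norm x) \<and> (\<forall>x\<in>?F. \<gamma> x = 0)}"
  have "(\<lambda>_. 0) \<in> G"
    using \<open>B > 0\<close> by (auto simp: G_def intro!: bounded_clinearI[where K = 0])
  \<comment> \<open>\<open>P n j \<gamma>\<close> expresses closeness of \<open>f n\<close> and \<open>\<gamma>\<close> to order \<open>j\<close> in the topology of pointwise
    convergence, which is metrised on bounded sets by the points \<open>d i\<close> of the dense set.\<close>
  define P where "P n j \<gamma> \<longleftrightarrow> (\<forall>i\<le>j. cmod (f n (d i) - \<gamma> (d i)) < 1 / real (Suc j))" for n j \<gamma>
  have near: "\<forall>\<^sub>F n in sequentially. \<exists>\<gamma>\<in>G. P n j \<gamma>" for j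
  proof (rule ccontr)
    assume "\<not> ?thesis"
    then have "\<exists>\<^sub>\<infinity>n. \<not> (\<exists>\<gamma>\<in>G. P n j \<gamma>)"
      by (simp add: frequently_def cofinite_eq_sequentially)
    then obtain s where s: "strict_mono (s :: nat \<Rightarrow> nat)" "\<And>k. \<not> (\<exists>\<gamma>\<in>G. P (s k) j \<gamma>)"
      using infinite_enumerate[of "{n. \<not> (\<exists>\<gamma>\<in>G. P n j \<gamma>)}"] by (auto simp: INFM_iff_infinite)
    obtain r \<gamma> where r: "strict_mono (r :: nat \<Rightarrow> nat)" and \<gamma>: "bounded_clinear \<gamma>" "\<And>x. cmod (\<gamma> x) \<le> ?M * norm x"
      and lim: "\<And>x. (\<lambda>n. f (s (r n)) x) \<longlonglongrightarrow> \<gamma> x"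
      using bounded_functionals_subsequence[OF D f(1) f(2) \<open>?M > 0\<close>, of s] by metis
    have "\<gamma> x = 0" if "x \<in> ?F" for x
    proof -
      obtain a where a: "a \<in> c0" "x = h a" using \<open>x \<in> ?F\<close> by blast
      have "(\<lambda>n. apply_bcontfun a (s (r n))) \<longlonglongrightarrow> 0"
        using LIMSEQ_subseq_LIMSEQ[OF c0_tendsto[OF a(1)] strict_mono_o[OF s(1) r]] by (simp add: o_def)
      then show ?thesis
        using lim[of x] LIMSEQ_unique by (simp add: a fh)
    qed
    with \<gamma> have "\<gamma> \<in> G" by (simp add: G_def)
    have "\<forall>\<^sub>F n in sequentially. \<forall>i\<in>{..j}. cmod (f (s (r n)) (d i) - \<gamma> (d i)) < 1 / real (Suc j)"
    proof (rule eventually_ball_finite, simp, intro ballI)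
      fix i
      show "\<forall>\<^sub>F n in sequentially. cmod (f (s (r n)) (d i) - \<gamma> (d i)) < 1 / real (Suc j)"
        using tendstoD[OF lim[of "d i"], of "1 / real (Suc j)"] by (simp add: dist_norm)
    qed
    then obtain n where "P (s (r n)) j \<gamma>"
      by (auto simp: P_def eventually_sequentially)
    with s(2) \<open>\<gamma> \<in> G\<close> show False by blast
  qed
  have P_mono: "P n i \<gamma>" if "i \<le> j" "P n j \<gamma>" for n i j \<gamma>
  proof -
    have "1 / real (Suc j) \<le> 1 / real (Suc i)" using \<open>i \<le> j\<close> by (simp add: frac_le)
    then show ?thesis using that unfolding P_def by (meson less_le_trans order_trans)
  qed
  have "G \<noteq> {}" using \<open>(\<lambda>_. 0) \<in> G\<close> by blast
  have "\<exists>\<gamma>. (\<forall>n. \<gamma> n \<in> G) \<and> (\<forall>j. \<forall>\<^sub>F n in sequentially. P n j (\<gamma> n))"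
    by (rule diagonal_choice[of G P, OF \<open>G \<noteq> {}\<close> P_mono near])
  then obtain \<gamma> where \<gamma>G: "\<And>n. \<gamma> n \<in> G" and \<gamma>P: "\<And>j. \<forall>\<^sub>F n in sequentially. P n j (\<gamma> n)"
    by blast
  have \<gamma>: "bounded_clinear (\<gamma> n)" "cmod (\<gamma> n x) \<le> ?M * norm x" "a \<in> c0 \<Longrightarrow> \<gamma> n (h a) = 0" for n x a
    using \<gamma>G[of n] by (auto simp: G_def)
  define \<phi> where "\<phi> n x = f n x - \<gamma> n x" for n x
  have bound: "cmod (\<phi> n x) \<le> 2 * ?M * norm x" for n x
    using norm_triangle_ineq4[of "f n x" "\<gamma> n x"] f(2)[of n x] \<gamma>(2)[of n x] by (simp add: \<phi>_def)
  have lin: "bounded_clinear (\<phi> n)" for n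
    by (rule bounded_clinearI[OF _ _ bound])
      (simp_all add: \<phi>_def bounded_clinear_add[OF f(1)] bounded_clinear_add[OF \<gamma>(1)]
        bounded_clinear_scaleC[OF f(1)] bounded_clinear_scaleC[OF \<gamma>(1)] scaleC_complex_def algebra_simps)
  have "(\<lambda>n. \<phi> n x) \<longlonglongrightarrow> 0" for x
  proof (rule tendsto_0_if_tendsto_0_on_dense[OF _ _ D(2)])
    show "cmod (\<phi> n x - \<phi> n y) \<le> 2 * ?M * norm (x - y)" for n x y
      using bound[of n "x - y"] by (simp add: bounded_clinear_diff[OF lin])
    show "2 * ?M > 0" using \<open>B > 0\<close> by simp
    fix x assume "x \<in> D"
    then obtain i where i: "x = d i" using d by blast
    show "(\<lambda>n. \<phi> n x) \<longlonglongrightarrow> 0"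
    proof (rule tendstoI)
      fix e :: real assume "e > 0"
      then obtain k where k: "1 / real (Suc k) < e" using nat_approx_posE by blast
      show "\<forall>\<^sub>F n in sequentially. dist (\<phi> n x) 0 < e"
        using \<gamma>P[of "max i k"]
      proof eventually_elim
        case (elim n)
        then have "cmod (\<phi> n x) < 1 / real (Suc (max i k))" by (simp add: P_def \<phi>_def i)
        also have "\<dots> \<le> 1 / real (Suc k)" by (simp add: frac_le)
        finally show ?case using k by simp
      qed
    qed
  qed
  moreover have "\<phi> n (h a) = apply_bcontfun a n" if "a \<in> c0" for n a
    using that by (simp add: \<phi>_def fh \<gamma>(3))
  moreover have "2 * ?M > 0" using \<open>B > 0\<close> by simp
  ultimately show thesis using that lin bound by blast
qed

section \<open>A diagonal operator on complemented copies of \<open>c\<^sub>0\<close>\<close>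

text \<open>Pointwise limits of a subsequence exist entry by entry, and the common null sequence \<open>\<beta>\<close>
controls the tails, so the convergence is uniform.\<close>

lemma compact_dominated_c0:
  fixes \<beta> :: "nat \<Rightarrow> real"
  assumes "\<beta> \<longlonglongrightarrow> 0"
  shows "compact {a \<in> c0. \<forall>n. cmod (apply_bcontfun a n) \<le> \<beta> n}" (is "compact ?K")
  unfolding compact_def
proof (intro allI impI)
  fix f :: "nat \<Rightarrow> (nat, complex) bcontfun"
  assume "\<forall>k. f k \<in> ?K"
  then have f: "cmod (apply_bcontfun (f k) n) \<le> \<beta> n" for k n
    by blast
  obtain M where M: "\<And>n. \<bar>\<beta> n\<bar> \<le> M"
    using Bseq_def[THEN iffD1, OF convergent_imp_Bseq[OF convergentI[OF assms]]] by auto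
  have f_le_M: "cmod (apply_bcontfun (f k) n) \<le> M" for k n
    using f[of k n] M[of n] by linarith
  have "\<exists>r. strict_mono (r :: nat \<Rightarrow> nat) \<and> (\<forall>n. \<exists>l. (\<lambda>k. apply_bcontfun (f (r k)) n) \<longlonglongrightarrow> l)"
  proof (rule function_convergent_subsequence[of UNIV "\<lambda>k. apply_bcontfun (f k)" M])
    show "countable (UNIV :: nat set)" by simp
    show "cmod (apply_bcontfun (f k) n) \<le> M" for k n by (rule f_le_M)
  qed blast
  then obtain r where r: "strict_mono (r :: nat \<Rightarrow> nat)"
    "\<And>n. \<exists>l. (\<lambda>k. apply_bcontfun (f (r k)) n) \<longlonglongrightarrow> l"
    by blast
  then obtain l where l: "\<And>n. (\<lambda>k. apply_bcontfun (f (r k)) n) \<longlonglongrightarrow> l n"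
    by metis
  have l_le: "cmod (l n) \<le> \<beta> n" for n
    using f by (intro tendsto_upperbound[OF tendsto_norm[OF l]]) auto
  then have "l \<longlonglongrightarrow> 0"
    by (intro Lim_null_comparison[OF _ assms]) auto
  then obtain b where b: "b \<in> c0" "apply_bcontfun b = l"
    by (rule obtain_c0)
  have "(f \<circ> r) \<longlonglongrightarrow> b"
  proof (rule LIMSEQ_I)
    fix e :: real assume "e > 0"
    then obtain N where N: "\<And>n. n \<ge> N \<Longrightarrow> \<bar>\<beta> n\<bar> < e / 4"
      using LIMSEQ_D[OF assms, of "e / 4"] by auto
    have "\<forall>\<^sub>F k in sequentially. \<forall>n\<in>{..<N}. cmod (apply_bcontfun (f (r k)) n - l n) < e / 2"
    proof (rule eventually_ball_finite, simp, intro ballI)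
      fix n
      show "\<forall>\<^sub>F k in sequentially. cmod (apply_bcontfun (f (r k)) n - l n) < e / 2"
        using tendstoD[OF l[of n], of "e / 2"] \<open>e > 0\<close> by (simp add: dist_norm)
    qed
    then obtain k0 where k0: "\<And>k n. k \<ge> k0 \<Longrightarrow> n < N \<Longrightarrow> cmod (apply_bcontfun (f (r k)) n - l n) < e / 2"
      by (auto simp: eventually_sequentially)
    have "norm ((f \<circ> r) k - b) < e" if "k \<ge> k0" for k
    proof -
      have "norm ((f \<circ> r) k - b) \<le> e / 2"
      proof (rule norm_bound)
        fix n
        have "cmod (apply_bcontfun (f (r k)) n - l n) \<le> e / 2"
        proof (cases "n < N")
          case True
          then show ?thesis using k0[OF that True] by simp
        next
          case False
          then have "\<bar>\<beta> n\<bar> < e / 4" using N by simp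
          then show ?thesis
            using norm_triangle_ineq4[of "apply_bcontfun (f (r k)) n" "l n"] f[of "r k" n] l_le[of n]
            by linarith
        qed
        then show "cmod (apply_bcontfun ((f \<circ> r) k - b) n) \<le> e / 2"
          by (simp add: minus_bcontfun.rep_eq b(2))
      qed
      with \<open>e > 0\<close> show ?thesis by simp
    qed
    then show "\<exists>k0. \<forall>k\<ge>k0. norm ((f \<circ> r) k - b) < e" by blast
  qed
  moreover have "b \<in> ?K" using b l_le by simp
  ultimately show "\<exists>l\<in>?K. \<exists>r. strict_mono r \<and> (f \<circ> r) \<longlonglongrightarrow> l"
    using r(1) by blast
qed

text \<open>The entry with index \<open>0\<close> serves as the limit of the sequence. Thus \<open>w\<close> is a convergent
sequence of unimodular numbers, with its limit recorded in front.\<close>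

definition unimodular :: "(nat \<Rightarrow> complex) \<Rightarrow> bool"
  where "unimodular w \<longleftrightarrow> (\<forall>n. cmod (w n) = 1) \<and> w \<longlonglongrightarrow> w 0"

lemma unimodular_norm: "unimodular w \<Longrightarrow> cmod (w n) = 1"
  by (simp add: unimodular_def)

lemma unimodular_mult: "unimodular v \<Longrightarrow> unimodular w \<Longrightarrow> unimodular (\<lambda>n. v n * w n)"
  by (auto simp: unimodular_def norm_mult intro: tendsto_mult)

lemma unimodular_power: "unimodular w \<Longrightarrow> unimodular (\<lambda>n. w n ^ k)"
  by (auto simp: unimodular_def norm_power intro: tendsto_power)

lemma unimodular_cnj: "unimodular w \<Longrightarrow> unimodular (\<lambda>n. cnj (w n))"
  by (auto simp: unimodular_def intro: tendsto_cnj)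

text \<open>The limit \<open>- 1\<close> is a square root of \<open>1\<close> other than \<open>1\<close>: this separates \<open>m = 2\<close> from \<open>m = 1\<close>.
The angles \<open>pi / n\<close> are such that the \<open>n\<close>-th power of the \<open>n\<close>-th entry is opposite to the \<open>n\<close>-th
power of the limit. Division by zero yields \<open>0\<close>, so the entry with index \<open>0\<close> is indeed the limit.\<close>

definition critical_weight :: "nat \<Rightarrow> complex"
  where "critical_weight n = - cis (pi / real n)"

lemma critical_weight_0: "critical_weight 0 = - 1"
  by (simp add: critical_weight_def)

lemma unimodular_critical_weight: "unimodular critical_weight"
proof -
  have "(\<lambda>n. pi / real n) \<longlonglongrightarrow> 0"
    by (rule lim_const_over_n)
  then have "(\<lambda>n. - cis (pi / real n)) \<longlonglongrightarrow> - cis 0"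
    by (intro tendsto_intros)
  then show ?thesis
    by (simp add: unimodular_def critical_weight_def[abs_def])
qed

text \<open>A copy \<open>h\<close> of \<open>c\<^sub>0\<close> together with coordinate functionals \<open>\<phi> n\<close> on the whole space, as
Sobczyk's theorem provides them; \<open>x \<mapsto> h (\<phi> n x)\<^sub>n\<close> is then a projection onto the copy.\<close>

locale complemented_c0 =
  fixes h :: "(nat, complex) bcontfun \<Rightarrow> 'a::complex_banach" and \<phi> :: "nat \<Rightarrow> 'a \<Rightarrow> complex"
    and B C :: real
  assumes h_add: "a \<in> c0 \<Longrightarrow> b \<in> c0 \<Longrightarrow> h (a + b) = h a + h b"
    and h_scale: "a \<in> c0 \<Longrightarrow> h (c *\<^sub>C a) = c *\<^sub>C h a"
    and h_bound: "a \<in> c0 \<Longrightarrow> norm (h a) \<le> B * norm a" and B_pos: "B > 0"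
    and \<phi>_clinear: "bounded_clinear (\<phi> n)"
    and \<phi>_bound: "cmod (\<phi> n x) \<le> C * norm x" and C_pos: "C > 0"
    and \<phi>_tendsto: "(\<lambda>n. \<phi> n x) \<longlonglongrightarrow> 0"
    and \<phi>_h: "a \<in> c0 \<Longrightarrow> \<phi> n (h a) = apply_bcontfun a n"
begin

lemmas \<phi>_add = bounded_clinear_add[OF \<phi>_clinear]
  and \<phi>_diff = bounded_clinear_diff[OF \<phi>_clinear]
  and \<phi>_scaleC = bounded_clinear_scaleC[OF \<phi>_clinear, unfolded scaleC_complex_def]

text \<open>On the space \<open>c\<close> of convergent sequences, multiplication by the sequence \<open>w\<close> is a diagonal
operator. The space \<open>c\<close> is isomorphic to \<open>c\<^sub>0\<close>: let \<open>b \<in> c\<^sub>0\<close> correspond to the convergent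
sequence \<open>b n + b 0\<close> (\<open>n \<ge> 1\<close>) with limit \<open>b 0\<close>. In these coordinates the diagonal operator
becomes \<open>b n \<mapsto> w n b n + (w n - w 0) b 0\<close>, and the same formula gives \<open>w 0 b 0\<close> for \<open>n = 0\<close>. The
operator \<open>multiply w\<close> acts in this way on the copy of \<open>c\<^sub>0\<close> and as the identity on the kernel of
the projection; \<open>increment w\<close> contains the coordinates of its difference to the identity.\<close>

definition increment :: "(nat \<Rightarrow> complex) \<Rightarrow> 'a \<Rightarrow> (nat, complex) bcontfun"
  where "increment w x = Bcontfun (\<lambda>n. (w n - 1) * \<phi> n x + (w n - w 0) * \<phi> 0 x)"

definition multiply :: "(nat \<Rightarrow> complex) \<Rightarrow> 'a \<Rightarrow> 'a"
  where "multiply w x = x + h (increment w x)"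

lemma increment_tendsto:
  assumes "unimodular w"
  shows "(\<lambda>n. (w n - 1) * \<phi> n x + (w n - w 0) * \<phi> 0 x) \<longlonglongrightarrow> 0"
proof -
  have w: "w \<longlonglongrightarrow> w 0" using assms by (simp add: unimodular_def)
  have "(\<lambda>n. (w n - 1) * \<phi> n x + (w n - w 0) * \<phi> 0 x) \<longlonglongrightarrow> (w 0 - 1) * 0 + (w 0 - w 0) * \<phi> 0 x"
    by (intro tendsto_intros w \<phi>_tendsto)
  then show ?thesis by simp
qed

lemma increment_c0: "unimodular w \<Longrightarrow> increment w x \<in> c0"
  unfolding increment_def by (rule Bcontfun_null_sequence_c0[OF increment_tendsto])

lemma apply_increment: "unimodular w \<Longrightarrow> apply_bcontfun (increment w x) n = (w n - 1) * \<phi> n x + (w n - w 0) * \<phi> 0 x"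
  unfolding increment_def by (simp add: apply_Bcontfun_null_sequence[OF increment_tendsto])

lemma \<phi>_multiply: "unimodular w \<Longrightarrow> \<phi> n (multiply w x) = w n * \<phi> n x + (w n - w 0) * \<phi> 0 x"
  by (simp add: multiply_def \<phi>_add \<phi>_h increment_c0 apply_increment algebra_simps)

lemma multiply_mult:
  assumes "unimodular v" "unimodular w"
  shows "multiply v (multiply w x) = multiply (\<lambda>n. v n * w n) x"
proof -
  have "increment w x + increment v (multiply w x) = increment (\<lambda>n. v n * w n) x"
    by (rule bcontfun_eqI)
      (simp add: plus_bcontfun.rep_eq apply_increment assms unimodular_mult \<phi>_multiply algebra_simps)
  moreover have "multiply v (multiply w x) = x + h (increment w x + increment v (multiply w x))"
    using assms by (simp add: multiply_def h_add increment_c0)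
  ultimately show ?thesis by (simp add: multiply_def)
qed

lemma multiply_one: "multiply (\<lambda>_. 1) = id"
proof
  fix x
  have "increment (\<lambda>_. 1) x = 0"
    by (rule bcontfun_eqI) (simp add: apply_increment unimodular_def)
  moreover have "h 0 = 0" using h_scale[OF c0_0, of 0] by simp
  ultimately show "multiply (\<lambda>_. 1) x = id x" by (simp add: multiply_def)
qed

lemma multiply_funpow: "unimodular w \<Longrightarrow> multiply w ^^ k = multiply (\<lambda>n. w n ^ k)"
  by (induction k) (auto simp: multiply_one multiply_mult unimodular_power)

lemma multiply_bound:
  assumes w: "unimodular w"
  shows "norm (multiply w x) \<le> (1 + 4 * B * C) * norm x"
proof -
  have "norm (increment w x) \<le> 4 * C * norm x"
  proof (rule norm_bound)
    fix n
    have "cmod (apply_bcontfun (increment w x) n) \<le> cmod (w n - 1) * cmod (\<phi> n x) + cmod (w n - w 0) * cmod (\<phi> 0 x)"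
      unfolding apply_increment[OF w] norm_mult[symmetric] by (rule norm_triangle_ineq)
    also have "\<dots> \<le> 2 * (C * norm x) + 2 * (C * norm x)"
      using norm_triangle_ineq4[of "w n" 1] norm_triangle_ineq4[of "w n" "w 0"]
      by (intro add_mono mult_mono \<phi>_bound) (auto simp: unimodular_norm[OF w])
    finally show "cmod (apply_bcontfun (increment w x) n) \<le> 4 * C * norm x" by simp
  qed
  then have "B * norm (increment w x) \<le> B * (4 * C * norm x)"
    using B_pos by (intro mult_left_mono) auto
  with h_bound[OF increment_c0[OF w], of x] norm_triangle_ineq[of x "h (increment w x)"] show ?thesis
    by (simp add: multiply_def algebra_simps)
qed

lemma multiply_clinear: "unimodular w \<Longrightarrow> bounded_clinear (multiply w)"
proof (rule bounded_clinearI[OF _ _ multiply_bound])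
  assume w: "unimodular w"
  show "multiply w (x + y) = multiply w x + multiply w y" for x y
  proof -
    have "increment w (x + y) = increment w x + increment w y"
      by (rule bcontfun_eqI) (simp add: plus_bcontfun.rep_eq apply_increment w \<phi>_add algebra_simps)
    then show ?thesis by (simp add: multiply_def h_add increment_c0 w)
  qed
  show "multiply w (c *\<^sub>C x) = c *\<^sub>C multiply w x" for c x
  proof -
    have "increment w (c *\<^sub>C x) = c *\<^sub>C increment w x"
      by (rule bcontfun_eqI)
        (simp add: scaleC_bcontfun.rep_eq scaleC_complex_def apply_increment w \<phi>_scaleC algebra_simps)
    then show ?thesis by (simp add: multiply_def h_scale increment_c0 w scaleC_add_right)
  qed
qed

lemma multiply_power_bounded:
  assumes "unimodular w"
  shows "power_bounded (multiply w)"
  unfolding power_bounded_def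
proof (rule bdd_aboveI)
  fix y assume "y \<in> {onorm (multiply w ^^ n) |n. n \<ge> 1}"
  then obtain n where "y = onorm (multiply w ^^ n)" by blast
  then show "y \<le> 1 + 4 * B * C"
    using B_pos C_pos multiply_bound[OF unimodular_power[OF assms]]
    by (simp add: multiply_funpow[OF assms] onorm_bound)
qed

lemma multiply_doubly_power_bounded:
  assumes "unimodular w"
  shows "doubly_power_bounded (multiply w)"
proof -
  have "cnj (w n) * w n = 1" for n
    using complex_norm_square[of "w n"] unimodular_norm[OF assms, of n] by (simp add: mult.commute)
  then have "multiply (\<lambda>n. cnj (w n)) \<circ> multiply w = id" "multiply w \<circ> multiply (\<lambda>n. cnj (w n)) = id"
    by (auto simp: fun_eq_iff multiply_mult assms unimodular_cnj multiply_one mult.commute)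
  then show ?thesis
    unfolding doubly_power_bounded_def
    using multiply_clinear multiply_power_bounded assms unimodular_cnj by blast
qed

text \<open>As \<open>v 0 = 1\<close>, every element of the range of \<open>I - multiply v\<close> is of the form \<open>h b\<close> with
\<open>b 0 = 0\<close>, that is, a null sequence in the picture of \<open>c\<close>. On such elements \<open>multiply w\<close>
multiplies every entry by a unimodular number, so the orbit stays in the compact set of sequences
dominated by \<open>b\<close>.\<close>

lemma orbits_compact_if_limit_1:
  assumes w: "unimodular w" and v: "unimodular v" "v 0 = 1"
  shows "relatively_compact_orbits_on (multiply w) (range (\<lambda>x. x - multiply v x))"
  unfolding relatively_compact_orbits_on_def
proof
  fix y assume "y \<in> range (\<lambda>x. x - multiply v x)"
  then obtain x where x: "y = x - multiply v x" by blast
  define b where "b = (- 1) *\<^sub>C increment v x"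
  have b: "b \<in> c0" unfolding b_def by (intro c0_scaleC increment_c0 v)
  have "y = h b"
    using h_scale[OF increment_c0[OF v(1)], of "- 1" x] by (simp add: x b_def multiply_def scaleC_one)
  let ?K = "{a \<in> c0. \<forall>n. cmod (apply_bcontfun a n) \<le> cmod (apply_bcontfun b n)}"
  have "(multiply w ^^ k) y \<in> h ` ?K" for k
  proof -
    let ?w = "\<lambda>n. w n ^ k"
    have wk: "unimodular ?w" by (rule unimodular_power[OF w])
    have b0: "apply_bcontfun b 0 = 0"
      using v by (simp add: b_def scaleC_bcontfun.rep_eq scaleC_complex_def apply_increment)
    have "apply_bcontfun (b + increment ?w y) n = ?w n * apply_bcontfun b n" for n
      by (simp add: plus_bcontfun.rep_eq apply_increment[OF wk] \<open>y = h b\<close> \<phi>_h[OF b] b0 algebra_simps)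
    then have "b + increment ?w y \<in> ?K"
      using c0_add[OF b increment_c0[OF wk]] by (simp add: norm_mult norm_power unimodular_norm[OF w])
    moreover have "(multiply w ^^ k) y = h (b + increment ?w y)"
      by (simp add: multiply_funpow[OF w] multiply_def h_add b increment_c0[OF wk] \<open>y = h b\<close>)
    ultimately show ?thesis by blast
  qed
  moreover have "compact (h ` ?K)"
  proof (rule compact_continuous_image)
    show "compact ?K"
      using tendsto_norm[OF c0_tendsto[OF b]] by (intro compact_dominated_c0) simp
    have "B-lipschitz_on c0 h"
    proof (rule lipschitz_onI)
      fix a b :: "(nat, complex) bcontfun" assume ab: "a \<in> c0" "b \<in> c0"
      have "h (a - b) = h a - h b"
        using h_add[OF c0_diff[OF ab] ab(2)] by (simp add: algebra_simps)
      with h_bound[OF c0_diff[OF ab]] show "dist (h a) (h b) \<le> B * dist a b"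
        by (simp add: dist_norm)
    qed (use B_pos in simp)
    then show "continuous_on ?K h"
      by (rule continuous_on_subset[OF lipschitz_on_continuous_on]) blast
  qed
  ultimately show "compact (closure {(multiply w ^^ n) y |n. n \<ge> 1})"
    by (intro compact_closure_subset[of "h ` ?K"]) auto
qed

text \<open>For the constant sequence \<open>1\<close> in the picture of \<open>c\<close>, encoded as \<open>unit_vector 0\<close>, the
difference \<open>y\<close> keeps a nonzero limit, because \<open>- 1 \<noteq> 1\<close>. After \<open>n\<close> steps its \<open>n\<close>-th entry has been
turned to the side opposite to the limit, so the \<open>n\<close>-th coordinate functional has modulus at least
\<open>2\<close> there. But on a relatively compact set the coordinate functionals tend to \<open>0\<close> uniformly.\<close>

lemma orbits_not_compact: "\<not> relatively_compact_orbits_on (multiply critical_weight) (range (\<lambda>x. x - multiply critical_weight x))"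
proof
  assume cpt: "relatively_compact_orbits_on (multiply critical_weight) (range (\<lambda>x. x - multiply critical_weight x))"
  define x where "x = h (unit_vector 0)"
  define y where "y = x - multiply critical_weight x"
  have \<phi>_x: "\<phi> n x = (if n = 0 then 1 else 0)" for n
    by (simp add: x_def \<phi>_h unit_vector_c0 apply_unit_vector)
  have \<phi>_y: "\<phi> n y = (if n = 0 then 2 else - (critical_weight n + 1))" for n
    by (simp add: y_def \<phi>_diff \<phi>_multiply[OF unimodular_critical_weight] \<phi>_x critical_weight_0)
  have large: "2 \<le> cmod (\<phi> n ((multiply critical_weight ^^ n) y))" if "n \<ge> 1" for n
  proof -
    have "cis (pi / real n) ^ n = - 1"
      using that by (simp only: Complex.DeMoivre) simp
    then have "critical_weight n ^ n = - ((- 1) ^ n)"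
      by (simp add: critical_weight_def power_minus[of "cis _"])
    moreover have "\<phi> n ((multiply critical_weight ^^ n) y) = critical_weight n ^ n * \<phi> n y + (critical_weight n ^ n - critical_weight 0 ^ n) * \<phi> 0 y"
      by (simp add: multiply_funpow[OF unimodular_critical_weight] \<phi>_multiply[OF unimodular_power[OF unimodular_critical_weight]])
    ultimately have "\<phi> n ((multiply critical_weight ^^ n) y) = (- 1) ^ n * (critical_weight n - 3)"
      using that by (simp add: \<phi>_y critical_weight_0 algebra_simps)
    then have "cmod (\<phi> n ((multiply critical_weight ^^ n) y)) = cmod (3 - critical_weight n)"
      by (simp add: norm_mult norm_power norm_minus_commute)
    also have "\<dots> \<ge> cmod 3 - cmod (critical_weight n)"
      by (rule norm_triangle_ineq2)
    finally show ?thesis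
      by (simp add: unimodular_norm[OF unimodular_critical_weight])
  qed
  have "compact (closure {(multiply critical_weight ^^ n) y |n. n \<ge> 1})" (is "compact (closure ?O)")
    using cpt by (simp add: relatively_compact_orbits_on_def y_def)
  moreover have "\<forall>k. (multiply critical_weight ^^ Suc k) y \<in> closure ?O"
  proof
    fix k
    have "1 \<le> Suc k" by simp
    then have "(multiply critical_weight ^^ Suc k) y \<in> ?O" by blast
    then show "(multiply critical_weight ^^ Suc k) y \<in> closure ?O" by (rule subsetD[OF closure_subset])
  qed
  ultimately obtain z r where r: "strict_mono (r :: nat \<Rightarrow> nat)"
    and z: "(\<lambda>k. (multiply critical_weight ^^ Suc (r k)) y) \<longlonglongrightarrow> z"
    unfolding compact_def o_def by meson
  have "2 \<le> C * norm ((multiply critical_weight ^^ Suc (r k)) y - z) + cmod (\<phi> (Suc (r k)) z)" for k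
    using large[of "Suc (r k)"] \<phi>_bound[of "Suc (r k)" "(multiply critical_weight ^^ Suc (r k)) y - z"]
      norm_triangle_ineq[of "\<phi> (Suc (r k)) ((multiply critical_weight ^^ Suc (r k)) y - z)" "\<phi> (Suc (r k)) z"]
    by (simp add: \<phi>_diff)
  moreover have "(\<lambda>k. C * norm ((multiply critical_weight ^^ Suc (r k)) y - z) + cmod (\<phi> (Suc (r k)) z)) \<longlonglongrightarrow> C * norm (z - z) + cmod 0"
    using LIMSEQ_subseq_LIMSEQ[OF LIMSEQ_Suc[OF \<phi>_tendsto] r]
    by (intro tendsto_intros z) (simp add: o_def)
  ultimately have "2 \<le> C * norm (z - z) + cmod 0"
    by (intro tendsto_lowerbound) auto
  then show False by simp
qed

end

text \<open>Stated for a function on a set closed under scaling, since an embedding of \<open>c\<^sub>0\<close> and its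
inverse are linear only on \<open>c\<^sub>0\<close> and on the image, respectively.\<close>

lemma homogeneous_continuous_imp_bounded:
  fixes f :: "'a::real_normed_vector \<Rightarrow> 'b::real_normed_vector"
  assumes "continuous_on S f" "0 \<in> S"
    and S: "\<And>t x. x \<in> S \<Longrightarrow> t *\<^sub>R x \<in> S"
    and f: "\<And>t x. x \<in> S \<Longrightarrow> f (t *\<^sub>R x) = t *\<^sub>R f x"
  obtains B where "B > 0" "\<And>x. x \<in> S \<Longrightarrow> norm (f x) \<le> B * norm x"
proof -
  have f0: "f 0 = 0" using f[OF \<open>0 \<in> S\<close>, of 0] by simp
  obtain d where d: "d > 0" "\<And>x. x \<in> S \<Longrightarrow> norm x < d \<Longrightarrow> norm (f x) < 1"
    using continuous_on_iff[THEN iffD1, OF assms(1)] \<open>0 \<in> S\<close> f0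
    by (metis dist_0_norm dist_commute zero_less_one)
  have "norm (f x) \<le> 2 / d * norm x" if "x \<in> S" for x
  proof (cases "x = 0")
    case False
    define t where "t = d / (2 * norm x)"
    have "t > 0" using d(1) False by (simp add: t_def)
    have "norm (t *\<^sub>R x) < d" using d(1) False by (simp add: t_def)
    then have "norm (f (t *\<^sub>R x)) < 1" using d(2) S that by blast
    then have "t * norm (f x) < 1" using f[OF that, of t] \<open>t > 0\<close> by simp
    then show ?thesis using d(1) False by (simp add: t_def field_simps)
  qed (simp add: f0)
  with d(1) show thesis by (intro that[of "2 / d"]) auto
qed

text \<open>A homeomorphic linear embedding of \<open>c\<^sub>0\<close> is bounded in both directions, so Sobczyk's theorem
applies to it and the diagonal operator of \<open>critical_weight\<close> is available.\<close>

theorem counterexample_if_copy_of_c0: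
  assumes sep: "separable_space (euclidean :: 'a::complex_banach topology)"
    and copy: "contains_copy_of_c0 TYPE('a::complex_banach)"
  obtains T :: "'a::complex_banach \<Rightarrow> 'a" where "bounded_clinear T" "doubly_power_bounded T"
    "relatively_compact_orbits_on T (range (\<lambda>x. x - (T ^^ 2) x))"
    "\<not> relatively_compact_orbits_on T (range (\<lambda>x. x - (T ^^ 1) x))"
proof -
  obtain F :: "'a set" and h g where F: "scaleC.subspace F"
    and add: "\<And>a b. a \<in> c0 \<Longrightarrow> b \<in> c0 \<Longrightarrow> h (a + b) = h a + h b"
    and scale: "\<And>c a. a \<in> c0 \<Longrightarrow> h (c *\<^sub>C a) = c *\<^sub>C h a"
    and hom: "homeomorphism c0 F h g"
    using copy unfolding contains_copy_of_c0_def by (elim exE conjE) (rule that; blast)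
  have F_eq: "F = h ` c0" and gh: "\<And>a. a \<in> c0 \<Longrightarrow> g (h a) = a"
    using hom by (auto simp: homeomorphism_def)
  have scaleR_c0: "t *\<^sub>R a \<in> c0" if "a \<in> c0" for t a
    using c0_scaleC[OF that, of "of_real t"] by (simp add: scaleC_of_real)
  have h_scaleR: "h (t *\<^sub>R a) = t *\<^sub>R h a" if "a \<in> c0" for t a
    using scale[OF that, of "of_real t"] by (simp add: scaleC_of_real)
  obtain B where B: "B > 0" "\<And>a. a \<in> c0 \<Longrightarrow> norm (h a) \<le> B * norm a"
    using homogeneous_continuous_imp_bounded[OF homeomorphism_cont1[OF hom] c0_0 scaleR_c0 h_scaleR]
    by blast
  have "0 \<in> F" and scaleR_F: "\<And>t x. x \<in> F \<Longrightarrow> t *\<^sub>R x \<in> F"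
    using F by (simp_all add: scaleC.subspace_def flip: scaleC_of_real)
  have g_scaleR: "g (t *\<^sub>R x) = t *\<^sub>R g x" if "x \<in> F" for t x
  proof -
    obtain a where "a \<in> c0" "x = h a" using \<open>x \<in> F\<close> F_eq by blast
    then show ?thesis using gh[OF scaleR_c0, of a t] by (simp add: h_scaleR gh)
  qed
  obtain B' where B': "B' > 0" "\<And>x. x \<in> F \<Longrightarrow> norm (g x) \<le> B' * norm x"
    using homogeneous_continuous_imp_bounded[OF homeomorphism_cont2[OF hom] \<open>0 \<in> F\<close> scaleR_F g_scaleR]
    by blast
  have below: "norm a \<le> B' * norm (h a)" if "a \<in> c0" for a
    using B'(2)[of "h a"] that by (simp add: F_eq gh)
  have "\<exists>\<phi> C. complemented_c0 h \<phi> B C"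
  proof (rule sobczyk[OF sep F[unfolded F_eq] add scale below B'(1)])
    fix \<phi> C
    assume "\<And>n. bounded_clinear (\<phi> n)" "C > 0" "\<And>n x. cmod (\<phi> n x) \<le> C * norm x"
      "\<And>x. (\<lambda>n. \<phi> n x) \<longlonglongrightarrow> 0" "\<And>n a. a \<in> c0 \<Longrightarrow> \<phi> n (h a) = apply_bcontfun a n"
    then have "complemented_c0 h \<phi> B C"
      by unfold_locales (simp_all add: add scale B)
    then show ?thesis by blast
  qed
  then obtain \<phi> C where "complemented_c0 h \<phi> B C" by blast
  then interpret complemented_c0 h \<phi> B C .
  show thesis
  proof
    show "bounded_clinear (multiply critical_weight)" "doubly_power_bounded (multiply critical_weight)"
      by (simp_all add: multiply_clinear multiply_doubly_power_bounded unimodular_critical_weight)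
    show "relatively_compact_orbits_on (multiply critical_weight) (range (\<lambda>x. x - (multiply critical_weight ^^ 2) x))"
      using unimodular_critical_weight unimodular_power[OF unimodular_critical_weight, of 2]
      by (simp add: multiply_funpow[OF unimodular_critical_weight] critical_weight_0 orbits_compact_if_limit_1)
    show "\<not> relatively_compact_orbits_on (multiply critical_weight) (range (\<lambda>x. x - (multiply critical_weight ^^ 1) x))"
      using orbits_not_compact by simp
  qed
qed

section \<open>The characterisation\<close>

theorem theorem4p2:
  shows "let
      a = (\<not> contains_copy_of_c0 TYPE('a::complex_banach));
      b = (\<forall>T :: 'a \<Rightarrow> 'a.
            bounded_clinear T \<and> power_bounded T \<and> power_bounded_below T \<longrightarrow>
            ((\<exists>m\<ge>1. relatively_compact_orbits_on T (range (\<lambda>x. x - (T ^^ m) x))) \<longleftrightarrow>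
             (\<forall>m\<ge>1. relatively_compact_orbits_on T (range (\<lambda>x. x - (T ^^ m) x)))));
      c = (\<forall>T :: 'a \<Rightarrow> 'a.
            bounded_clinear T \<and> doubly_power_bounded T \<longrightarrow>
            ((\<exists>m\<ge>1. relatively_compact_orbits_on T (range (\<lambda>x. x - (T ^^ m) x))) \<longleftrightarrow>
             (\<forall>m\<ge>1. relatively_compact_orbits_on T (range (\<lambda>x. x - (T ^^ m) x)))))
    in (a \<longrightarrow> b) \<and> (b \<longrightarrow> c) \<and>
       (separable_space (euclidean :: 'a topology) \<longrightarrow> (a \<longleftrightarrow> b) \<and> (b \<longleftrightarrow> c))"
proof -
  let ?a = "\<not> contains_copy_of_c0 TYPE('a)"
  let ?E = "\<lambda>T :: 'a \<Rightarrow> 'a.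
    (\<exists>m\<ge>1. relatively_compact_orbits_on T (range (\<lambda>x. x - (T ^^ m) x))) \<longleftrightarrow>
    (\<forall>m\<ge>1. relatively_compact_orbits_on T (range (\<lambda>x. x - (T ^^ m) x)))"
  let ?b = "\<forall>T. bounded_clinear T \<and> power_bounded T \<and> power_bounded_below T \<longrightarrow> ?E T"
  let ?c = "\<forall>T. bounded_clinear T \<and> doubly_power_bounded T \<longrightarrow> ?E T"
  have ab: "?b" if "?a"
  proof (intro allI impI iffI)
    fix T :: "'a \<Rightarrow> 'a" and k :: nat
    assume T: "bounded_clinear T \<and> power_bounded T \<and> power_bounded_below T"
    assume "\<exists>m\<ge>1. relatively_compact_orbits_on T (range (\<lambda>x. x - (T ^^ m) x))"
    then show "relatively_compact_orbits_on T (range (\<lambda>x. x - (T ^^ k) x))"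
      using all_orbits_compact_if_no_copy_of_c0[OF that bounded_clinear_imp_bounded_linear] T by blast
  qed blast
  have bc: "?c" if "?b"
    using that doubly_power_bounded_imp_below by blast
  have ca: "?a" if c: "?c" and sep: "separable_space (euclidean :: 'a topology)"
  proof
    assume "contains_copy_of_c0 TYPE('a)"
    then obtain T :: "'a \<Rightarrow> 'a" where T: "bounded_clinear T" "doubly_power_bounded T"
      "relatively_compact_orbits_on T (range (\<lambda>x. x - (T ^^ 2) x))"
      "\<not> relatively_compact_orbits_on T (range (\<lambda>x. x - (T ^^ 1) x))"
      by (rule counterexample_if_copy_of_c0[OF sep])
    from c T(1,2) have "?E T" by blast
    moreover have "\<exists>m\<ge>1. relatively_compact_orbits_on T (range (\<lambda>x. x - (T ^^ m) x))"
      using T(3) by (intro exI[of _ 2]) simp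
    ultimately show False using T(4) by blast
  qed
  show ?thesis
    unfolding Let_def using ab bc ca by argo
qed

end
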